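(* Let $f\in\mathbb{K}[x_1,\ldots,x_n]$ be a polynomial and let $\ell=\dim_{\mathbb{K}}\operatorname{Ap}(f)$. Suppose that $$\dim_{\mathbb{K}}\operatorname{Ap}(f^d)=\binom{\ell+d-1}{d}$$ for $d=1,2,\ldots,\deg f$. Then $f$ is encompassing.
   Context: $\mathbb{K}$ is an algebraically closed field of characteristic zero. $\mathcal{D}=\mathbb{K}[\alpha_1,\ldots,\alpha_n]$ acts on $\mathbb{K}[x_1,\ldots,x_n]$ by letting $\alpha_i$ act as $\partial/\partial x_i$ (written $\sigma\circ f$); $\operatorname{Ann}(f)=\{\sigma\in\mathcal{D}:\sigma\circ f=0\}$ and $\operatorname{Ap}(f)=\mathcal{D}/\operatorname{Ann}(f)$. A polynomial $f$ is encompassing if no nonzero $g\in\mathcal{D}\circ f$ satisfies $g_{\leq1}=0$, where $g_{\leq1}$ is the sum of the homogeneous parts of $g$ of degrees $0$ and $1$. *)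

theory Defs
  imports
    "HOL-Library.Poly_Mapping"
    "HOL-Algebra.Embedded_Algebras"
    "HOL-Algebra.QuotRing"
    "HOL-Algebra.Algebraic_Closure_Type"
begin

text \<open>
  Polynomials over \<open>'k\<close> in finitely many variables indexed by the finite type \<open>'n\<close>: a monomial is
  its exponent vector, a polynomial the finitely supported family of its coefficients, with the
  convolution product of \<^theory>\<open>HOL-Library.Poly_Mapping\<close>. The same type is used both for
  \<open>\<bbbK>[x\<^sub>1,\<dots>,x\<^sub>n]\<close> and for \<open>\<D> = \<bbbK>[\<alpha>\<^sub>1,\<dots>,\<alpha>\<^sub>n]\<close>.
\<close>

type_synonym ('n, 'k) mpoly = "('n \<Rightarrow>\<^sub>0 nat) \<Rightarrow>\<^sub>0 'k"

definition mvar :: "'n \<Rightarrow> ('n, 'k::comm_ring_1) mpoly" where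
  "mvar i = Poly_Mapping.single (Poly_Mapping.single i 1) 1"

definition mconst :: "'k \<Rightarrow> ('n, 'k::comm_ring_1) mpoly" where
  "mconst c = Poly_Mapping.single 0 c"

definition mdeg :: "('n::finite \<Rightarrow>\<^sub>0 nat) \<Rightarrow> nat" where
  "mdeg m = (\<Sum>i\<in>UNIV. Poly_Mapping.lookup m i)"

text \<open>The total degree, with the convention that the zero polynomial has degree \<open>0\<close>.\<close>

definition total_degree :: "('n::finite, 'k::comm_ring_1) mpoly \<Rightarrow> nat" where
  "total_degree f = Max (insert 0 (mdeg ` Poly_Mapping.keys f))"

definition hom_part :: "nat \<Rightarrow> ('n::finite, 'k::comm_ring_1) mpoly \<Rightarrow> ('n, 'k) mpoly" where
  "hom_part k g =
     (\<Sum>m | m \<in> Poly_Mapping.keys g \<and> mdeg m = k. Poly_Mapping.single m (Poly_Mapping.lookup g m))"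

text \<open>
  The partial derivative with respect to the variable \<open>i\<close>. The truncated subtraction of exponent
  vectors is harmless: when the exponent of \<open>i\<close> in \<open>m\<close> is \<open>0\<close>, the coefficient vanishes.
\<close>

definition partial :: "'n \<Rightarrow> ('n, 'k::comm_ring_1) mpoly \<Rightarrow> ('n, 'k) mpoly" where
  "partial i f = (\<Sum>m\<in>Poly_Mapping.keys f.
     Poly_Mapping.single (m - Poly_Mapping.single i 1)
       (of_nat (Poly_Mapping.lookup m i) * Poly_Mapping.lookup f m))"

text \<open>
  The composition of the operators \<open>(\<partial>/\<partial>x\<^sub>i)\<^bsup>a\<^sub>i\<^esup>\<close> over all variables \<open>i\<close>; the order of
  composition is irrelevant by \<open>comp_fun_commute_partial\<close> below.
\<close>

definition partial_monom ::
    "('n::finite \<Rightarrow>\<^sub>0 nat) \<Rightarrow> ('n, 'k::comm_ring_1) mpoly \<Rightarrow> ('n, 'k) mpoly" where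
  "partial_monom a f = Finite_Set.fold (\<lambda>i. partial i ^^ Poly_Mapping.lookup a i) f UNIV"

definition diff_act ::
    "('n::finite, 'k::comm_ring_1) mpoly \<Rightarrow> ('n, 'k) mpoly \<Rightarrow> ('n, 'k) mpoly" where
  "diff_act \<sigma> f =
     (\<Sum>a\<in>Poly_Mapping.keys \<sigma>. mconst (Poly_Mapping.lookup \<sigma> a) * partial_monom a f)"

definition Ann :: "('n::finite, 'k::comm_ring_1) mpoly \<Rightarrow> ('n, 'k) mpoly set" where
  "Ann f = {\<sigma>. diff_act \<sigma> f = 0}"

definition Ap :: "('n::finite, 'k::comm_ring_1) mpoly \<Rightarrow> ('n, 'k) mpoly set ring" where
  "Ap f = ring_of_type_algebra Quot (Ann f)"

text \<open>The image of the ground field \<open>\<bbbK>\<close> in \<open>Ap f\<close>, consisting of the classes of constants.\<close>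

definition Ap_scalars :: "('n::finite, 'k::comm_ring_1) mpoly \<Rightarrow> ('n, 'k) mpoly set set" where
  "Ap_scalars f = range (\<lambda>c. Ann f +>\<^bsub>ring_of_type_algebra\<^esub> mconst c)"

text \<open>
  The dimension of \<open>Ap f\<close> over \<open>\<bbbK>\<close> is \<open>l\<close>. For \<open>f = 0\<close>, the algebra \<open>Ap f\<close> and
  \<open>Ap_scalars f\<close> collapse to a single element, and the dimension is \<open>0\<close>.
\<close>

definition Ap_dim :: "('n::finite, 'k::comm_ring_1) mpoly \<Rightarrow> nat \<Rightarrow> bool" where
  "Ap_dim f l \<longleftrightarrow> ring.dimension (Ap f) l (Ap_scalars f) (carrier (Ap f))"

definition encompassing :: "('n::finite, 'k::comm_ring_1) mpoly \<Rightarrow> bool" where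
  "encompassing f \<longleftrightarrow>
     \<not> (\<exists>g \<in> range (\<lambda>\<sigma>. diff_act \<sigma> f). g \<noteq> 0 \<and> hom_part 0 g + hom_part 1 g = 0)"


text \<open>The operation \<^const>\<open>diff_act\<close> is a module structure in which \<open>\<alpha>\<^sub>i\<close> acts as \<open>\<partial>/\<partial>x\<^sub>i\<close>.\<close>

lemma lookup_partial:
  "Poly_Mapping.lookup (partial i f) m =
     of_nat (Suc (Poly_Mapping.lookup m i)) * Poly_Mapping.lookup f (m + Poly_Mapping.single i 1)"
proof -
  let ?e = "Poly_Mapping.single i (1::nat)"
  let ?t = "\<lambda>m'. of_nat (Poly_Mapping.lookup m' i) * Poly_Mapping.lookup f m'"
  have eq: "(?t m' when m' - ?e = m) = (?t m' when m' = m + ?e)" for m'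
  proof (cases "Poly_Mapping.lookup m' i = 0")
    case True
    then have "m' \<noteq> m + ?e"
      by (metis add_eq_0_iff_both_eq_0 lookup_add lookup_single_eq one_neq_zero)
    then show ?thesis using True by (simp add: when_def)
  next
    case False
    then have "m' = m' - ?e + ?e"
      by (intro poly_mapping_eqI) (auto simp: lookup_add lookup_minus lookup_single when_def)
    then have "m' - ?e = m \<longleftrightarrow> m' = m + ?e"
      by (metis add_diff_cancel_right')
    then show ?thesis by simp
  qed
  have "Poly_Mapping.lookup (partial i f) m =
      (\<Sum>m'\<in>Poly_Mapping.keys f. ?t m' when m' - ?e = m)"
    unfolding partial_def lookup_sum lookup_single by simp
  also have "\<dots> = (\<Sum>m'\<in>Poly_Mapping.keys f. ?t m' when m' = m + ?e)"
    unfolding eq by simp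
  also have "\<dots> = ?t (m + ?e)"
    by (simp add: when_def in_keys_iff)
  finally show ?thesis by (simp add: lookup_add)
qed

lemma partial_add: "partial i (f + g) = partial i f + partial i g"
  by (intro poly_mapping_eqI) (simp add: lookup_partial lookup_add algebra_simps)

lemma lookup_mconst_mult: "Poly_Mapping.lookup (mconst c * f) m = c * Poly_Mapping.lookup f m"
proof -
  have *: "Poly_Mapping.map ((*) c) f = mconst c * f"
    unfolding mconst_def by (rule mult_map_scale_conv_mult)
  show ?thesis
    unfolding *[symmetric] by (simp add: map.rep_eq when_def)
qed

lemma partial_mconst_mult: "partial i (mconst c * f) = mconst c * partial i f"
  by (intro poly_mapping_eqI) (simp add: lookup_partial lookup_mconst_mult mult.left_commute)

lemma partial_commute: "partial i (partial j f) = partial j (partial i f)"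
proof (intro poly_mapping_eqI)
  fix m
  show "Poly_Mapping.lookup (partial i (partial j f)) m = Poly_Mapping.lookup (partial j (partial i f)) m"
    by (cases "i = j") (simp_all add: lookup_partial lookup_add lookup_single add.commute
        add.left_commute mult.left_commute)
qed

lemma comp_fun_commute_partial:
  fixes a :: "'n \<Rightarrow>\<^sub>0 nat"
  shows "comp_fun_commute (\<lambda>i. partial i ^^ Poly_Mapping.lookup a i ::
           ('n, 'k::comm_ring_1) mpoly \<Rightarrow> ('n, 'k) mpoly)"
proof
  fix i j :: 'n
  have *: "(partial i ^^ p) (partial j f) = partial j ((partial i ^^ p) f)"
    for p and f :: "('n, 'k) mpoly"
    by (induction p) (simp_all add: partial_commute)
  have comm: "(partial i ^^ p) ((partial j ^^ q) f) = (partial j ^^ q) ((partial i ^^ p) f)"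
    for p q and f :: "('n, 'k) mpoly"
    by (induction q) (simp_all add: *)
  show "(partial j ^^ Poly_Mapping.lookup a j) \<circ> (partial i ^^ Poly_Mapping.lookup a i) =
      (partial i ^^ Poly_Mapping.lookup a i) \<circ>
      (partial j ^^ Poly_Mapping.lookup a j :: ('n, 'k) mpoly \<Rightarrow> ('n, 'k) mpoly)"
    by (intro ext, unfold o_apply, rule comm[symmetric])
qed

lemma partial_monom_induct:
  assumes "P f" "\<And>i g. P g \<Longrightarrow> P (partial i g)"
  shows "P (partial_monom a f)"
proof -
  interpret comp_fun_commute "\<lambda>i. partial i ^^ Poly_Mapping.lookup a i"
    by (rule comp_fun_commute_partial)
  have step: "P ((partial i ^^ k) g)" if "P g" for i k g
    using that by (induction k) (auto intro: assms(2))
  have "P (Finite_Set.fold (\<lambda>i. partial i ^^ Poly_Mapping.lookup a i) f S)" if "finite S" for S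
    using that by (induction S) (simp_all add: assms(1) step)
  then show ?thesis unfolding partial_monom_def by simp
qed

lemma partial_monom_hom:
  assumes "\<And>i g. h (partial i g) = partial i (h g)"
  shows "h (partial_monom a f) = partial_monom a (h f)"
proof -
  interpret comp_fun_commute "\<lambda>i. partial i ^^ Poly_Mapping.lookup a i"
    by (rule comp_fun_commute_partial)
  have step: "h ((partial i ^^ k) g) = (partial i ^^ k) (h g)" for i k g
    by (induction k) (auto simp: assms)
  have "h (Finite_Set.fold (\<lambda>i. partial i ^^ Poly_Mapping.lookup a i) f S) =
      Finite_Set.fold (\<lambda>i. partial i ^^ Poly_Mapping.lookup a i) (h f) S" if "finite S" for S
    using that by (induction S) (simp_all add: step)
  then show ?thesis unfolding partial_monom_def by simp
qed

lemma partial_monom_add: "partial_monom a (f + g) = partial_monom a f + partial_monom a g"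
proof -
  interpret comp_fun_commute "\<lambda>i. partial i ^^ Poly_Mapping.lookup a i"
    by (rule comp_fun_commute_partial)
  have step: "(partial i ^^ k) (u + v) = (partial i ^^ k) u + (partial i ^^ k) v"
    for i k and u v :: "('a, 'b) mpoly"
    by (induction k) (auto simp: partial_add)
  have "Finite_Set.fold (\<lambda>i. partial i ^^ Poly_Mapping.lookup a i) (f + g) S =
      Finite_Set.fold (\<lambda>i. partial i ^^ Poly_Mapping.lookup a i) f S +
      Finite_Set.fold (\<lambda>i. partial i ^^ Poly_Mapping.lookup a i) g S" if "finite S" for S
    using that by (induction S) (simp_all add: step)
  then show ?thesis unfolding partial_monom_def by simp
qed

lemma partial_monom_mconst_mult: "partial_monom a (mconst c * f) = mconst c * partial_monom a f"
  by (rule partial_monom_hom[symmetric]) (simp add: partial_mconst_mult)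

lemma partial_monom_plus: "partial_monom (a + b) f = partial_monom a (partial_monom b f)"
proof -
  interpret A: comp_fun_commute "\<lambda>i. partial i ^^ Poly_Mapping.lookup a i"
    by (rule comp_fun_commute_partial)
  interpret B: comp_fun_commute "\<lambda>i. partial i ^^ Poly_Mapping.lookup b i"
    by (rule comp_fun_commute_partial)
  interpret AB: comp_fun_commute "\<lambda>i. partial i ^^ Poly_Mapping.lookup (a + b) i"
    by (rule comp_fun_commute_partial)
  let ?F = "\<lambda>a. Finite_Set.fold (\<lambda>i. partial i ^^ Poly_Mapping.lookup a i)"
  have c1: "(partial i ^^ k) (partial j f) = partial j ((partial i ^^ k) f)"
    for i j k and f :: "('a, 'b) mpoly"
    by (induction k) (simp_all add: partial_commute)
  have c2: "?F a (partial j f) S = partial j (?F a f S)" if "finite S"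
    for S j and f :: "('a, 'b) mpoly"
    using that by (induction S) (simp_all add: c1)
  have c3: "?F a ((partial j ^^ k) f) S = (partial j ^^ k) (?F a f S)" if "finite S"
    for S j k and f :: "('a, 'b) mpoly"
    using that by (induction k) (simp_all add: c2)
  have "?F (a + b) f S = ?F a (?F b f S) S" if "finite S" for S
    using that
  proof (induction S)
    case (insert x S)
    have "(partial x ^^ Poly_Mapping.lookup (a + b) x) (?F a (?F b f S) S) =
        (partial x ^^ Poly_Mapping.lookup a x) (?F a ((partial x ^^ Poly_Mapping.lookup b x) (?F b f S)) S)"
      using insert.hyps by (simp add: c3 lookup_add funpow_add)
    then show ?case
      by (simp only: AB.fold_insert[OF insert.hyps] A.fold_insert[OF insert.hyps]
          B.fold_insert[OF insert.hyps] insert.IH)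
  qed simp
  then show ?thesis unfolding partial_monom_def by simp
qed

lemma partial_monom_0: "partial_monom 0 f = f"
proof -
  interpret comp_fun_commute "\<lambda>i. partial i ^^ Poly_Mapping.lookup 0 i"
    by (rule comp_fun_commute_partial)
  have "Finite_Set.fold (\<lambda>i. partial i ^^ Poly_Mapping.lookup 0 i) f S = f" if "finite S" for S
    using that
  proof (induction S)
    case (insert x S)
    show ?case
      unfolding fold_insert[OF insert.hyps] insert.IH by simp
  qed simp
  then show ?thesis unfolding partial_monom_def by simp
qed

lemma partial_monom_single: "partial_monom (Poly_Mapping.single i 1) f = partial i f"
proof -
  interpret comp_fun_commute "\<lambda>j. partial j ^^ Poly_Mapping.lookup (Poly_Mapping.single i 1) j"
    by (rule comp_fun_commute_partial)
  let ?F = "Finite_Set.fold (\<lambda>j. partial j ^^ Poly_Mapping.lookup (Poly_Mapping.single i 1) j) f"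
  have "?F S = (if i \<in> S then partial i f else f)" if "finite S" for S
    using that
  proof (induction S)
    case (insert x S)
    then show ?case
      unfolding fold_insert[OF insert.hyps] insert.IH using insert.hyps by (auto simp: lookup_single when_def)
  qed simp
  then show ?thesis unfolding partial_monom_def by simp
qed

lemma mconst_add: "mconst (a + b) = mconst a + mconst b"
  by (simp add: mconst_def single_add)

lemma mconst_0 [simp]: "mconst 0 = 0"
  by (simp add: mconst_def)

lemma mconst_1 [simp]: "mconst 1 = 1"
  by (simp add: mconst_def)

lemma mconst_mult: "mconst (a * b) = mconst a * mconst b"
  by (simp add: mconst_def mult_single)

lemma diff_act_superset:
  assumes "finite S" "Poly_Mapping.keys \<sigma> \<subseteq> S"
  shows "diff_act \<sigma> f = (\<Sum>a\<in>S. mconst (Poly_Mapping.lookup \<sigma> a) * partial_monom a f)"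
  unfolding diff_act_def using assms
  by (intro sum.mono_neutral_left) (auto simp: in_keys_iff)

lemma diff_act_single: "diff_act (Poly_Mapping.single a c) f = mconst c * partial_monom a f"
  by (subst diff_act_superset[of "{a}"]) auto

lemma diff_act_add_left: "diff_act (\<sigma> + \<tau>) f = diff_act \<sigma> f + diff_act \<tau> f"
proof -
  let ?S = "Poly_Mapping.keys \<sigma> \<union> Poly_Mapping.keys \<tau>"
  have "Poly_Mapping.keys (\<sigma> + \<tau>) \<subseteq> ?S" by (rule keys_add)
  then show ?thesis
    by (simp add: diff_act_superset[of ?S] lookup_add mconst_add distrib_right sum.distrib)
qed

lemma diff_act_add_right: "diff_act \<sigma> (f + g) = diff_act \<sigma> f + diff_act \<sigma> g"
  by (simp add: diff_act_def partial_monom_add distrib_left sum.distrib)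

lemma diff_act_0_left [simp]: "diff_act 0 f = 0"
  by (simp add: diff_act_def)

lemma diff_act_0_right [simp]: "diff_act \<sigma> 0 = 0"
  using diff_act_add_right[of \<sigma> 0 0] by simp

lemma diff_act_mvar: "diff_act (mvar i) f = partial i f"
  using diff_act_single[of "Poly_Mapping.single i 1" 1 f] by (simp add: mvar_def partial_monom_single[unfolded One_nat_def])

lemma diff_act_mconst: "diff_act (mconst c) f = mconst c * f"
  using diff_act_single[of 0 c f] by (simp add: mconst_def partial_monom_0)

lemma mpoly_induct [case_names zero single add]:
  fixes \<sigma> :: "('n, 'k::comm_ring_1) mpoly"
  assumes "P 0" "\<And>a c. P (Poly_Mapping.single a c)" "\<And>\<sigma> \<tau>. P \<sigma> \<Longrightarrow> P \<tau> \<Longrightarrow> P (\<sigma> + \<tau>)"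
  shows "P \<sigma>"
proof -
  have "P (\<Sum>a\<in>S. Poly_Mapping.single a (Poly_Mapping.lookup \<sigma> a))" if "finite S" for S
    using that by (induction S) (auto intro: assms)
  moreover have "(\<Sum>a\<in>Poly_Mapping.keys \<sigma>. Poly_Mapping.single a (Poly_Mapping.lookup \<sigma> a)) = \<sigma>"
    by (intro poly_mapping_eqI) (auto simp: lookup_sum lookup_single when_def in_keys_iff)
  ultimately show ?thesis by (metis finite_keys)
qed

lemma diff_act_mult: "diff_act (\<sigma> * \<tau>) f = diff_act \<sigma> (diff_act \<tau> f)"
proof (induction \<sigma> rule: mpoly_induct)
  case (single a c)
  show ?case
  proof (induction \<tau> rule: mpoly_induct)
    case (single b d)
    show ?case
      by (simp add: mult_single diff_act_single partial_monom_plus partial_monom_mconst_mult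
          mconst_mult mult.assoc)
  qed (simp_all add: distrib_left diff_act_add_left diff_act_add_right)
qed (simp_all add: distrib_right diff_act_add_left)

lemma ideal_Ann: "ideal (Ann f) ring_of_type_algebra"
proof -
  let ?D = "ring_of_type_algebra :: ('a, 'b) mpoly ring"
  interpret ring ?D
    by (rule ring_from_type_algebra)
  have neg: "\<ominus>\<^bsub>?D\<^esub> \<sigma> = - \<sigma>" for \<sigma>
    by (intro minus_equality) (simp_all add: ring_of_type_algebra_def)
  have neg_act: "diff_act (- \<sigma>) f = - diff_act \<sigma> f" for \<sigma>
    using diff_act_add_left[of "- \<sigma>" \<sigma> f] by (simp add: eq_neg_iff_add_eq_0)
  have "subgroup (Ann f) (add_monoid ?D)"
  proof (rule subgroup.intro)
    show "inv\<^bsub>add_monoid ?D\<^esub> \<sigma> \<in> Ann f" if "\<sigma> \<in> Ann f" for \<sigma>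
      using that unfolding a_inv_def[symmetric] neg by (simp add: Ann_def neg_act)
  qed (auto simp: ring_of_type_algebra_def Ann_def diff_act_add_left)
  moreover have "\<tau> \<otimes>\<^bsub>?D\<^esub> \<sigma> \<in> Ann f" "\<sigma> \<otimes>\<^bsub>?D\<^esub> \<tau> \<in> Ann f" if "\<sigma> \<in> Ann f" for \<sigma> \<tau>
  proof -
    show *: "\<tau> \<otimes>\<^bsub>?D\<^esub> \<sigma> \<in> Ann f"
      using that by (simp add: ring_of_type_algebra_def Ann_def diff_act_mult)
    then show "\<sigma> \<otimes>\<^bsub>?D\<^esub> \<tau> \<in> Ann f"
      by (simp add: ring_of_type_algebra_def mult.commute)
  qed
  ultimately show ?thesis
    by (intro idealI ring_axioms)
qed

lemma cring_Ap: "cring (Ap f)"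
  unfolding Ap_def by (intro ideal.quotient_is_cring ideal_Ann cring_from_type_algebra)

end

theory Submission
  imports Defs "HOL-Computational_Algebra.Polynomial"
begin

text \<open>
  Let \<open>V = \<D> \<circ> f\<close> and \<open>d = deg f\<close>. By the Leibniz rule \<open>\<D> \<circ> f\<^sup>d\<close> is contained in the span of the
  \<open>d\<close>-fold products of elements of \<open>V\<close>, so the dimension hypothesis forces the \<open>d\<close>-fold products of
  any basis of \<open>V\<close> to be linearly independent. Suppose that \<open>0 \<noteq> g \<in> V\<close> has \<open>g\<^bsub>\<le>1\<^esub> = 0\<close>, and choose a basis
  consisting of \<open>1\<close>, \<open>g\<close> and further elements with constant term \<open>0\<close>. The linear functional \<open>\<phi>\<close> that reads
  off the coefficient of \<open>g \<cdot> 1\<^bsup>d-1\<^esup>\<close> behaves like a derivation at the origin. As \<open>V\<close> is closed under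
  translation, \<open>v (x + y) = \<Sum>\<^sub>b \<beta>\<^sub>b(x) b(y)\<close> with \<open>b, \<beta>\<^sub>b \<in> V\<close> for \<open>v \<in> V\<close>; hence, by induction,
  \<open>\<phi> (v (j x)) = j \<phi> v\<close> for \<open>j \<le> d\<close>. For \<open>v = g\<close> with homogeneous parts \<open>g\<^sub>r\<close>, the polynomials
  \<open>\<Sum>\<^sub>r \<phi>(g\<^sub>r) t\<^sup>r\<close> and \<open>\<phi>(g) t\<close> agree at \<open>t = 0, \<dots>, d\<close> and are therefore equal, so \<open>\<phi>(g) = \<phi>(g\<^sub>1) = 0\<close>,
  which contradicts \<open>\<phi>(g) = 1\<close>.
\<close>

section \<open>Derivatives and dilations\<close>

interpretation mpoly: vector_space "\<lambda>(c::'k::field) (p::('n, 'k) mpoly). mconst c * p"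
  by unfold_locales (simp_all add: distrib_left distrib_right mconst_add mconst_mult mult.assoc)

section \<open>Coefficients of products\<close>

lemma lookup_single_mult:
  fixes q :: "('n, 'k::comm_ring_1) mpoly"
  shows "Poly_Mapping.lookup (Poly_Mapping.single a c * q) m = (\<Sum>b | a + b = m. c * Poly_Mapping.lookup q b)"
proof (induction q rule: mpoly_induct)
  case (single b d)
  have "finite {b. a + b = m}"
    by (rule finite_subset[of _ "{m - a}"]) auto
  then show ?case
    by (auto simp: mult_single lookup_single when_def intro!: sum.neutral)
qed (simp_all add: distrib_left lookup_add sum.distrib)

text \<open>Each summand of \<open>m\<close> is bounded by \<open>m\<close> in every exponent, which
  leaves finitely many choices over a finite index type.\<close>

lemma finite_summands [simp]: "finite {(a, b). a + b = (m :: 'n::finite \<Rightarrow>\<^sub>0 nat)}"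
proof (rule finite_subset)
  let ?S = "{a. \<exists>b. a + b = m}"
  show "{(a, b). a + b = m} \<subseteq> ?S \<times> ?S"
    by auto (metis add.commute)
  have "Poly_Mapping.lookup ` ?S \<subseteq> PiE UNIV (\<lambda>i. {..Poly_Mapping.lookup m i})"
    by (auto simp: lookup_add)
  moreover have "finite (PiE UNIV (\<lambda>i. {..Poly_Mapping.lookup m i}))"
    by (intro finite_PiE) auto
  moreover have "inj_on Poly_Mapping.lookup ?S"
    by (intro inj_onI poly_mapping_eqI) simp
  ultimately have "finite ?S"
    by (meson finite_imageD finite_subset)
  then show "finite (?S \<times> ?S)" by simp
qed

lemma lookup_mpoly_mult:
  fixes p q :: "('n::finite, 'k::comm_ring_1) mpoly"
  shows "Poly_Mapping.lookup (p * q) m = (\<Sum>(a, b) | a + b = m. Poly_Mapping.lookup p a * Poly_Mapping.lookup q b)"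
proof (induction p rule: mpoly_induct)
  case (single a c)
  have "(\<Sum>(a', b) | a' + b = m. Poly_Mapping.lookup (Poly_Mapping.single a c) a' * Poly_Mapping.lookup q b) =
      (\<Sum>(a', b)\<in>Pair a ` {b. a + b = m}. c * Poly_Mapping.lookup q b)"
    by (intro sum.mono_neutral_cong_right) (auto simp: lookup_single when_def)
  also have "\<dots> = (\<Sum>b | a + b = m. c * Poly_Mapping.lookup q b)"
    by (subst sum.reindex) (auto simp: inj_on_def)
  finally show ?case by (simp add: lookup_single_mult)
qed (simp_all add: distrib_right lookup_add sum.distrib case_prod_unfold)

lemma lookup_mult_0:
  fixes p q :: "('n::finite, 'k::comm_ring_1) mpoly"
  shows "Poly_Mapping.lookup (p * q) 0 = Poly_Mapping.lookup p 0 * Poly_Mapping.lookup q 0"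
proof -
  have "{(a, b). a + b = (0 :: 'n \<Rightarrow>\<^sub>0 nat)} = {(0, 0)}"
    by (auto intro!: poly_mapping_eqI dest!: arg_cong[where f = "Poly_Mapping.lookup"] simp: fun_eq_iff lookup_add)
  then show ?thesis by (simp add: lookup_mpoly_mult)
qed

section \<open>Exponent vectors, factorials and the coefficients of derivatives\<close>

lemma mdeg_add: "mdeg (a + b) = mdeg a + mdeg b"
  by (simp add: mdeg_def lookup_add sum.distrib)

lemma mdeg_eq_0_iff: "mdeg m = 0 \<longleftrightarrow> m = 0"
  by (auto simp: mdeg_def intro: poly_mapping_eqI)

text \<open>The multi-index factorial m!, valued in the field so that Taylor coefficients can be
  divided by it.\<close>

definition mfact :: "('n::finite \<Rightarrow>\<^sub>0 nat) \<Rightarrow> 'k::field_char_0" where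
  "mfact m = (\<Prod>i\<in>UNIV. fact (Poly_Mapping.lookup m i))"

lemma mfact_nonzero [simp]: "mfact m \<noteq> 0"
  by (simp add: mfact_def)

lemma mfact_0 [simp]: "mfact 0 = 1"
  by (simp add: mfact_def)

lemma mfact_add_single:
  "(mfact (m + Poly_Mapping.single i 1) :: 'k::field_char_0) =
     of_nat (Suc (Poly_Mapping.lookup m i)) * mfact m"
proof -
  have "(mfact (m + Poly_Mapping.single i 1) :: 'k) =
     fact (Poly_Mapping.lookup m i + 1) * (\<Prod>j\<in>UNIV - {i}. fact (Poly_Mapping.lookup m j))"
    unfolding mfact_def by (subst prod.remove[of _ i]) (auto simp: lookup_add lookup_single)
  also have "\<dots> = of_nat (Suc (Poly_Mapping.lookup m i)) * mfact m"
    unfolding mfact_def by (subst (2) prod.remove[of _ i]) auto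
  finally show ?thesis .
qed

text \<open>A nonzero exponent vector has a positive entry, and removing 1 from it lowers
  \<open>mdeg\<close> by 1.\<close>

lemma exponent_induct [case_names zero add]:
  fixes a :: "'n::finite \<Rightarrow>\<^sub>0 nat"
  assumes "P 0" "\<And>i a. P a \<Longrightarrow> P (Poly_Mapping.single i 1 + a)"
  shows "P a"
proof (induction "mdeg a" arbitrary: a)
  case 0
  then show ?case using assms(1) by (simp add: mdeg_eq_0_iff)
next
  case (Suc n)
  then have "a \<noteq> 0" by (auto simp: mdeg_def)
  then obtain i where i: "Poly_Mapping.lookup a i \<noteq> 0"
    by (metis poly_mapping_eqI lookup_zero)
  define b where "b = a - Poly_Mapping.single i 1"
  have ab: "a = Poly_Mapping.single i 1 + b"
    using i by (intro poly_mapping_eqI) (auto simp: b_def lookup_add lookup_minus lookup_single when_def)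
  have "mdeg (Poly_Mapping.single i (1::nat)) = 1"
    by (simp add: mdeg_def lookup_single when_def)
  then have "n = mdeg b"
    using Suc.hyps(2) by (simp add: ab mdeg_add)
  then show ?case
    using Suc.hyps(1) assms(2) by (simp add: ab)
qed

text \<open>The coefficient form of \<partial>^a x^(k+a) = ((k+a)!/k!) x^k, with denominators
  cleared.\<close>

lemma mfact_lookup_partial_monom:
  "mfact k * Poly_Mapping.lookup (partial_monom a p) k = mfact (k + a) * Poly_Mapping.lookup p (k + a)"
proof (induction a arbitrary: k rule: exponent_induct)
  case zero
  then show ?case by (simp add: partial_monom_0)
next
  case (add i a)
  have "mfact k * Poly_Mapping.lookup (partial_monom (Poly_Mapping.single i 1 + a) p) k =
      mfact (k + Poly_Mapping.single i 1) * Poly_Mapping.lookup (partial_monom a p) (k + Poly_Mapping.single i 1)"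
    unfolding partial_monom_plus partial_monom_single lookup_partial mfact_add_single
    by (simp add: mult_ac)
  then show ?case by (simp add: add.IH add.assoc)
qed

lemma lookup_partial_monom_0: "Poly_Mapping.lookup (partial_monom a p) 0 = mfact a * Poly_Mapping.lookup p a"
  using mfact_lookup_partial_monom[of 0 a p] by simp

lemma partial_0 [simp]: "partial i 0 = 0"
  by (simp add: partial_def)

lemma partial_mult: "partial i (p * q) = partial i p * q + p * partial i q"
proof (induction p rule: mpoly_induct)
  case (single a c)
  show ?case
  proof (induction q rule: mpoly_induct)
    case (single b d)
    have part: "partial i (Poly_Mapping.single m e) =
      Poly_Mapping.single (m - Poly_Mapping.single i 1) (of_nat (Poly_Mapping.lookup m i) * e)" for m and e :: 'b
      by (cases "e = 0") (simp_all add: partial_def)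
    \<comment> \<open>Truncated subtraction can be moved into one factor only if the variable
      \<open>i\<close> occurs in it; if it does not, the derivative of that factor has coefficient
      zero. Hence the four cases.\<close>
    have shift: "m + m' - Poly_Mapping.single i 1 = m - Poly_Mapping.single i 1 + m'"
      if "Poly_Mapping.lookup m i \<noteq> 0" for m m' :: "'a \<Rightarrow>\<^sub>0 nat"
      using that by (intro poly_mapping_eqI) (auto simp: lookup_add lookup_minus lookup_single when_def)
    show ?case
    proof (cases "Poly_Mapping.lookup a i = 0"; cases "Poly_Mapping.lookup b i = 0")
      assume "Poly_Mapping.lookup a i = 0" "Poly_Mapping.lookup b i \<noteq> 0"
      then show ?thesis
        using shift[of b a] by (simp add: part mult_single lookup_add algebra_simps)
    next
      assume "Poly_Mapping.lookup a i \<noteq> 0" "Poly_Mapping.lookup b i = 0"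
      then show ?thesis
        using shift[of a b] by (simp add: part mult_single lookup_add algebra_simps)
    next
      assume "Poly_Mapping.lookup a i \<noteq> 0" "Poly_Mapping.lookup b i \<noteq> 0"
      then show ?thesis
        using shift[of a b] shift[of b a]
        by (simp add: part mult_single lookup_add algebra_simps flip: single_add)
    qed (simp add: part mult_single lookup_add)
  qed (simp_all add: distrib_left partial_add)
qed (simp_all add: distrib_right partial_add algebra_simps)

section \<open>Dilations, that is, the substitutions of c x for x, and Taylor expansion\<close>

definition dilate :: "'k::comm_ring_1 \<Rightarrow> ('n::finite, 'k) mpoly \<Rightarrow> ('n, 'k) mpoly" where
  "dilate c p = Poly_Mapping.mapp (\<lambda>m x. c ^ mdeg m * x) p"

lemma lookup_dilate: "Poly_Mapping.lookup (dilate c p) m = c ^ mdeg m * Poly_Mapping.lookup p m"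
  by (simp add: dilate_def lookup_mapp when_def in_keys_iff)

text \<open>The one-variable binomial theorems for all variables, multiplied together: choosing one
  summand from each factor amounts to choosing a decomposition \<open>a + b = m\<close>.\<close>

lemma sum_mfact_binomial:
  fixes c :: "'k::field_char_0"
  shows "(\<Sum>(a, b) | a + b = m. c ^ mdeg a * mfact m / (mfact a * mfact b)) = (c + 1) ^ mdeg m"
proof -
  let ?F = "\<lambda>i k. c ^ k * of_nat (Poly_Mapping.lookup m i choose k)"
  have "(c + 1) ^ mdeg m = (\<Prod>i\<in>UNIV. \<Sum>k\<le>Poly_Mapping.lookup m i. ?F i k)"
    by (simp add: mdeg_def power_sum binomial_ring mult_ac)
  also have "\<dots> = (\<Sum>g\<in>PiE UNIV (\<lambda>i. {..Poly_Mapping.lookup m i}). \<Prod>i\<in>UNIV. ?F i (g i))"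
    by (rule prod_sum_PiE) auto
  also have "\<dots> = (\<Sum>(a, b) | a + b = m. \<Prod>i\<in>UNIV. ?F i (Poly_Mapping.lookup a i))"
    unfolding case_prod_unfold
  proof (rule sum.reindex_bij_betw[symmetric, of "\<lambda>(a, b). Poly_Mapping.lookup a",
        unfolded case_prod_unfold, OF bij_betw_byWitness])
    let ?G = "\<lambda>g. (Abs_poly_mapping g, m - Abs_poly_mapping g)"
    show "\<forall>x\<in>{x. fst x + snd x = m}. ?G (Poly_Mapping.lookup (fst x)) = x"
      by (auto simp: lookup_inverse)
    show "\<forall>g\<in>PiE UNIV (\<lambda>i. {..Poly_Mapping.lookup m i}). Poly_Mapping.lookup (fst (?G g)) = g"
      by (simp add: Abs_poly_mapping_inverse)
    show "(\<lambda>x. Poly_Mapping.lookup (fst x)) ` {x. fst x + snd x = m} \<subseteq> PiE UNIV (\<lambda>i. {..Poly_Mapping.lookup m i})"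
      by (auto simp: lookup_add)
    show "?G ` PiE UNIV (\<lambda>i. {..Poly_Mapping.lookup m i}) \<subseteq> {x. fst x + snd x = m}"
      by (auto intro!: poly_mapping_eqI simp: lookup_add lookup_minus Abs_poly_mapping_inverse PiE_iff)
  qed
  also have "\<dots> = (\<Sum>(a, b) | a + b = m. c ^ mdeg a * mfact m / (mfact a * mfact b))"
  proof -
    have "(\<Prod>i\<in>UNIV. ?F i (Poly_Mapping.lookup a i)) = c ^ mdeg a * mfact m / (mfact a * mfact b)"
      if m: "a + b = m" for a b
    proof -
      have "?F i (Poly_Mapping.lookup a i) = c ^ Poly_Mapping.lookup a i *
          (fact (Poly_Mapping.lookup m i) / (fact (Poly_Mapping.lookup a i) * fact (Poly_Mapping.lookup b i)))" for i
        by (simp add: m[symmetric] lookup_add binomial_fact)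
      then show ?thesis
        by (simp add: mfact_def mdeg_def power_sum prod.distrib prod_dividef)
    qed
    then show ?thesis by (intro sum.cong) auto
  qed
  finally show ?thesis by simp
qed

text \<open>Operators commute, so \<partial>^a can be applied last; evaluation at the origin then
  reads off a Taylor coefficient.\<close>

lemma lookup_diff_act_partial_monom_0:
  "Poly_Mapping.lookup (diff_act \<sigma> (partial_monom a v)) 0 = mfact a * Poly_Mapping.lookup (diff_act \<sigma> v) a"
proof -
  have "diff_act \<sigma> (partial_monom a v) = partial_monom a (diff_act \<sigma> v)"
    using diff_act_mult[of \<sigma> "Poly_Mapping.single a 1" v]
      diff_act_mult[of "Poly_Mapping.single a 1" \<sigma> v]
    by (simp add: diff_act_single mult.commute)
  then show ?thesis by (simp add: lookup_partial_monom_0)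
qed

text \<open>This is Taylor's formula for \<open>v (c x + x)\<close>, with the derivatives of \<open>v\<close> expanded in \<open>B\<close>.\<close>

lemma dilate_add_1:
  fixes B :: "('n::finite, 'k::field_char_0) mpoly set"
  assumes expand: "\<And>a. partial_monom a v =
      (\<Sum>b\<in>B. mconst (Poly_Mapping.lookup (diff_act (\<sigma> b) (partial_monom a v)) 0) * b)"
  shows "dilate (c + 1) v = (\<Sum>b\<in>B. dilate c (diff_act (\<sigma> b) v) * b)"
proof (rule poly_mapping_eqI)
  fix m
  \<comment> \<open>This is v(x + y) = \<Sum>_b \<beta>_b(x) b(y) with
    \<open>\<beta>_b = diff_act (\<sigma> b) v\<close>, compared at the monomial x^a y^k.\<close>
  have key: "(\<Sum>b\<in>B. Poly_Mapping.lookup (diff_act (\<sigma> b) v) a * Poly_Mapping.lookup b k) =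
      mfact (a + k) / (mfact a * mfact k) * Poly_Mapping.lookup v (a + k)" for a k
  proof -
    have "mfact a * (\<Sum>b\<in>B. Poly_Mapping.lookup (diff_act (\<sigma> b) v) a * Poly_Mapping.lookup b k) = Poly_Mapping.lookup (partial_monom a v) k"
      by (subst expand) (simp add: lookup_diff_act_partial_monom_0 lookup_sum lookup_mconst_mult sum_distrib_left mult.assoc)
    moreover have "Poly_Mapping.lookup (partial_monom a v) k = mfact (a + k) / mfact k * Poly_Mapping.lookup v (a + k)"
      using mfact_lookup_partial_monom[of k a v] by (simp add: field_simps add.commute)
    ultimately show ?thesis by (simp add: field_simps)
  qed
  have "Poly_Mapping.lookup (\<Sum>b\<in>B. dilate c (diff_act (\<sigma> b) v) * b) m =
      (\<Sum>b\<in>B. \<Sum>(a, k) | a + k = m. c ^ mdeg a * Poly_Mapping.lookup (diff_act (\<sigma> b) v) a * Poly_Mapping.lookup b k)"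
    by (simp add: lookup_sum lookup_mpoly_mult lookup_dilate)
  also have "\<dots> = (\<Sum>(a, k) | a + k = m. c ^ mdeg a * (\<Sum>b\<in>B. Poly_Mapping.lookup (diff_act (\<sigma> b) v) a * Poly_Mapping.lookup b k))"
    by (subst sum.swap) (simp add: case_prod_unfold sum_distrib_left mult.assoc)
  also have "\<dots> = (\<Sum>(a, k) | a + k = m. c ^ mdeg a * mfact m / (mfact a * mfact k)) * Poly_Mapping.lookup v m"
    unfolding sum_distrib_right by (rule sum.cong) (auto simp: key)
  also have "\<dots> = Poly_Mapping.lookup (dilate (c + 1) v) m"
    by (simp add: sum_mfact_binomial lookup_dilate)
  finally show "Poly_Mapping.lookup (dilate (c + 1) v) m = Poly_Mapping.lookup (\<Sum>b\<in>B. dilate c (diff_act (\<sigma> b) v) * b) m" ..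
qed

section \<open>The module of derivatives\<close>

lemma diff_act_mconst_mult: "diff_act \<sigma> (mconst c * p) = mconst c * diff_act \<sigma> p"
  by (metis diff_act_mconst diff_act_mult mult.commute)

lemma diff_act_range_subspace: "mpoly.subspace (range (\<lambda>\<sigma>. diff_act \<sigma> f))"
  unfolding mpoly.subspace_def
proof (intro conjI ballI allI)
  show "0 \<in> range (\<lambda>\<sigma>. diff_act \<sigma> f)"
    by (rule range_eqI[of _ _ 0]) simp
next
  fix x y assume "x \<in> range (\<lambda>\<sigma>. diff_act \<sigma> f)" "y \<in> range (\<lambda>\<sigma>. diff_act \<sigma> f)"
  then show "x + y \<in> range (\<lambda>\<sigma>. diff_act \<sigma> f)"
    by (auto simp flip: diff_act_add_left)
next
  fix c x assume "x \<in> range (\<lambda>\<sigma>. diff_act \<sigma> f)"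
  then show "mconst c * x \<in> range (\<lambda>\<sigma>. diff_act \<sigma> f)"
    by (auto simp flip: diff_act_mconst diff_act_mult)
qed

text \<open>The map \<sigma> \<mapsto> \<sigma> \<circ> f has kernel \<open>Ann f\<close>, so it
  identifies \<open>Ap f\<close> with \<D> \<circ> f. The lemma carries the algebraic notion of
  dimension over to bases in the vector space of polynomials.\<close>

lemma Ap_dim_basis:
  fixes f :: "('n::finite, 'k::field) mpoly"
  assumes "Ap_dim f l"
  obtains B where "finite B" "mpoly.independent B" "card B = l"
    "mpoly.span B = range (\<lambda>\<sigma>. diff_act \<sigma> f)"
proof -
  let ?D = "ring_of_type_algebra :: ('n, 'k) mpoly ring"
  interpret I: ideal "Ann f" ?D by (rule ideal_Ann)
  interpret R: cring "Ap f" by (rule cring_Ap)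
  define cls where "cls = (\<lambda>\<sigma>. Ann f +>\<^bsub>?D\<^esub> \<sigma>)"
  have D: "carrier ?D = UNIV" "\<sigma> \<oplus>\<^bsub>?D\<^esub> \<tau> = \<sigma> + \<tau>" "\<sigma> \<otimes>\<^bsub>?D\<^esub> \<tau> = \<sigma> * \<tau>" "\<zero>\<^bsub>?D\<^esub> = 0" for \<sigma> \<tau>
    by (simp_all add: ring_of_type_algebra_def)
  have cls_add: "cls \<sigma> \<oplus>\<^bsub>Ap f\<^esub> cls \<tau> = cls (\<sigma> + \<tau>)" for \<sigma> \<tau>
    using I.a_rcos_sum[of \<sigma> \<tau>] by (simp add: cls_def Ap_def FactRing_def D)
  have cls_mult: "cls \<sigma> \<otimes>\<^bsub>Ap f\<^esub> cls \<tau> = cls (\<sigma> * \<tau>)" for \<sigma> \<tau>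
    using I.rcoset_mult_add[of \<sigma> \<tau>] by (simp add: cls_def Ap_def FactRing_def D)
  have carrier: "carrier (Ap f) = range cls"
    by (auto simp: Ap_def FactRing_def A_RCOSETS_def' cls_def D)
  have zero: "\<zero>\<^bsub>Ap f\<^esub> = Ann f" by (simp add: Ap_def FactRing_def)
  have diff: "diff_act (\<sigma> - \<tau>) f = diff_act \<sigma> f - diff_act \<tau> f" for \<sigma> \<tau>
    using diff_act_add_left[of "\<sigma> - \<tau>" \<tau> f] by (simp add: algebra_simps)
  have cls_eq: "cls \<sigma> = cls \<tau> \<longleftrightarrow> diff_act \<sigma> f = diff_act \<tau> f" for \<sigma> \<tau>
  proof
    assume "cls \<sigma> = cls \<tau>"
    moreover have "\<sigma> \<in> cls \<sigma>" by (auto simp: cls_def a_r_coset_def' D Ann_def)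
    ultimately obtain \<rho> where "\<rho> \<in> Ann f" "\<sigma> = \<rho> + \<tau>" by (auto simp: cls_def a_r_coset_def' D)
    then show "diff_act \<sigma> f = diff_act \<tau> f" by (simp add: diff_act_add_left Ann_def)
  next
    assume *: "diff_act \<sigma> f = diff_act \<tau> f"
    have "cls \<sigma>' \<subseteq> cls \<tau>'" if eq: "diff_act \<sigma>' f = diff_act \<tau>' f" for \<sigma>' \<tau>'
    proof
      fix x assume "x \<in> cls \<sigma>'"
      then have "x - \<tau>' \<in> Ann f" using eq by (auto simp: cls_def a_r_coset_def' D Ann_def diff diff_act_add_left)
      then show "x \<in> cls \<tau>'" by (auto simp: cls_def a_r_coset_def' D intro!: bexI[of _ "x - \<tau>'"])
    qed
    with * show "cls \<sigma> = cls \<tau>" by (metis subset_antisym)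
  qed
  have zero': "\<zero>\<^bsub>Ap f\<^esub> = cls 0"
    by (auto simp: zero cls_def a_r_coset_def' D)
  define act where "act = (\<lambda>E. {diff_act \<sigma> f | \<sigma>. cls \<sigma> \<in> E})"
  \<comment> \<open>Here \<open>act E\<close> is the image of \<open>E\<close> in \<D> \<circ> f.
    The inclusion in \<open>range cls\<close> is part of the claim so that elements of
    \<open>E\<close> can be lifted to operators in the induction step.\<close>
  have "E \<subseteq> range cls \<and> (\<exists>B. finite B \<and> mpoly.independent B \<and> card B = n \<and> mpoly.span B = act E)"
    if "R.dimension n K E" "K = Ap_scalars f" for n K E
    using that
  proof (induction rule: R.dimension.induct)
    case zero_dim
    have "cls \<sigma> \<in> {\<zero>\<^bsub>Ap f\<^esub>} \<longleftrightarrow> diff_act \<sigma> f = 0" for \<sigma>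
      by (simp add: zero' cls_eq)
    then have "act {\<zero>\<^bsub>Ap f\<^esub>} = {p. p = 0 \<and> (\<exists>\<sigma>. diff_act \<sigma> f = 0)}"
      unfolding act_def by auto
    also have "\<dots> = {0}"
      using diff_act_0_left[of f] by blast
    finally have "act {\<zero>\<^bsub>Ap f\<^esub>} = {0}" .
    then show ?case
      by (intro conjI exI[of _ "{}"]) (simp_all add: zero' mpoly.independent_empty)
  next
    case (Suc_dim v E n K)
    note IH = Suc_dim.IH[OF Suc_dim.prems]
    then obtain B where B: "finite B" "mpoly.independent B" "card B = n" "mpoly.span B = act E"
      by blast
    obtain \<tau> where v: "v = cls \<tau>" using Suc_dim by (auto simp: carrier)
    let ?w = "diff_act \<tau> f" and ?E = "R.line_extension K v E"
    have notin: "?w \<notin> mpoly.span B"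
      using Suc_dim.hyps by (auto simp: B act_def v) (metis cls_eq)
    have mem: "x \<in> ?E \<longleftrightarrow> (\<exists>k \<rho>. x = cls (mconst k * \<tau> + \<rho>) \<and> cls \<rho> \<in> E)" for x
    proof -
      have "x \<in> ?E \<longleftrightarrow> (\<exists>k. \<exists>e\<in>E. x = cls (mconst k) \<otimes>\<^bsub>Ap f\<^esub> cls \<tau> \<oplus>\<^bsub>Ap f\<^esub> e)"
        by (auto simp: R.line_extension_def Suc_dim.prems Ap_scalars_def cls_def set_add_def' r_coset_def v)
      also have "\<dots> \<longleftrightarrow> (\<exists>k \<rho>. x = cls (mconst k * \<tau> + \<rho>) \<and> cls \<rho> \<in> E)"
      proof
        assume "\<exists>k. \<exists>e\<in>E. x = cls (mconst k) \<otimes>\<^bsub>Ap f\<^esub> cls \<tau> \<oplus>\<^bsub>Ap f\<^esub> e"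
        then obtain k e where e: "e \<in> E" "x = cls (mconst k) \<otimes>\<^bsub>Ap f\<^esub> cls \<tau> \<oplus>\<^bsub>Ap f\<^esub> e"
          by blast
        then obtain \<rho> where "e = cls \<rho>" using IH by blast
        with e show "\<exists>k \<rho>. x = cls (mconst k * \<tau> + \<rho>) \<and> cls \<rho> \<in> E"
          by (metis cls_mult cls_add)
      qed (metis cls_mult cls_add)
      finally show ?thesis .
    qed
    \<comment> \<open>Adjoining the line through \<open>v\<close> to \<open>E\<close> corresponds to
      adjoining the vector \<open>?w\<close> to the basis of the image.\<close>
    have "act ?E = mpoly.span (insert ?w B)"
    proof (rule equalityI; rule subsetI)
      fix p assume "p \<in> act ?E"
      then obtain \<sigma> k \<rho> where *: "p = diff_act \<sigma> f" "cls \<sigma> = cls (mconst k * \<tau> + \<rho>)" "cls \<rho> \<in> E"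
        by (auto simp: act_def mem)
      then have "p - mconst k * ?w = diff_act \<rho> f"
        by (simp add: cls_eq diff_act_add_left diff_act_mult diff_act_mconst)
      then show "p \<in> mpoly.span (insert ?w B)"
        unfolding mpoly.span_breakdown_eq B act_def using *(3) by blast
    next
      fix p assume "p \<in> mpoly.span (insert ?w B)"
      then obtain k \<rho> where *: "p - mconst k * ?w = diff_act \<rho> f" "cls \<rho> \<in> E"
        unfolding mpoly.span_breakdown_eq B act_def by blast
      then have "p = diff_act (mconst k * \<tau> + \<rho>) f"
        by (simp add: diff_act_add_left diff_act_mult diff_act_mconst diff_eq_eq add.commute)
      moreover have "cls (mconst k * \<tau> + \<rho>) \<in> ?E"
        unfolding mem using *(2) by blast
      ultimately show "p \<in> act ?E" unfolding act_def by blast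
    qed
    moreover have "mpoly.independent (insert ?w B)"
      using B(2) notin by (rule mpoly.independent_insertI[rotated])
    moreover have "?w \<notin> B"
      using notin mpoly.span_base by blast
    then have "card (insert ?w B) = Suc n"
      using B(1,3) by simp
    moreover have "?E \<subseteq> range cls"
      using mem by blast
    moreover have "finite (insert ?w B)" using B(1) by simp
    ultimately show ?case
      by (intro conjI exI[of _ "insert ?w B"]) simp_all
  qed
  from this[OF assms[unfolded Ap_dim_def carrier] refl]
  obtain B where "finite B" "mpoly.independent B" "card B = l" "mpoly.span B = act (range cls)"
    by blast
  moreover have "act (range cls) = range (\<lambda>\<sigma>. diff_act \<sigma> f)"
    by (auto simp: act_def)
  ultimately show ?thesis using that by simp
qed

text \<open>\<D> is generated by the \<alpha>_i over the scalars, so a subspace stable under all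
  partial derivatives is a \<D>-submodule.\<close>

lemma diff_act_range_minimal:
  assumes "mpoly.subspace W" "p \<in> W" "\<And>i q. q \<in> W \<Longrightarrow> partial i q \<in> W"
  shows "range (\<lambda>\<sigma>. diff_act \<sigma> p) \<subseteq> W"
proof clarify
  fix \<sigma>
  have "partial_monom a p \<in> W" for a
    by (rule partial_monom_induct) (use assms in auto)
  then show "diff_act \<sigma> p \<in> W"
    unfolding diff_act_def by (intro mpoly.subspace_sum mpoly.subspace_scale assms(1))
qed

section \<open>Products of derivatives\<close>

text \<open>The factors are indexed by multisets, since distinct multisets may a priori have equal
  products; excluding this is half of \<open>products_independent\<close>.\<close>

definition products :: "('n, 'k::comm_ring_1) mpoly set \<Rightarrow> nat \<Rightarrow> ('n, 'k) mpoly set" where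
  "products B d = prod_mset ` multisets_of_size B d"

lemma mult_in_span_products:
  assumes "u \<in> mpoly.span B" "p \<in> mpoly.span (products B d)"
  shows "u * p \<in> mpoly.span (products B (Suc d))"
  using assms(2)
proof (induction rule: mpoly.span_induct_alt)
  case base
  then show ?case by (simp add: mpoly.span_zero)
next
  case (step c p q)
  from step(1) obtain M where M: "p = prod_mset M" "M \<in> multisets_of_size B d"
    by (auto simp: products_def)
  have "u * p \<in> mpoly.span (products B (Suc d))"
    using assms(1)
  proof (induction rule: mpoly.span_induct_alt)
    case base
    then show ?case by (simp add: mpoly.span_zero)
  next
    case (step c' b u')
    have "b * p \<in> products B (Suc d)"
      unfolding products_def using step(1) M
      by (intro image_eqI[of _ _ "add_mset b M"]) (auto simp: multisets_of_size_def)
    then show ?case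
      using mpoly.span_add[OF mpoly.span_scale[OF mpoly.span_base] step(2)]
      by (simp add: distrib_right mult.assoc)
  qed
  then show ?case
    using mpoly.span_add[OF mpoly.span_scale step(2), of "u * p" c]
    by (simp add: distrib_left mult.left_commute)
qed

lemma power_in_span_products:
  assumes "p \<in> mpoly.span B"
  shows "p ^ d \<in> mpoly.span (products B d)"
proof (induction d)
  case 0
  have "1 \<in> products B 0" by (simp add: products_def)
  then show ?case by (simp add: mpoly.span_base)
next
  case (Suc d)
  then show ?case using mult_in_span_products[OF assms] by simp
qed

text \<open>By the Leibniz rule, differentiation replaces one factor at a time by its derivative,
  which lies in the span of \<open>B\<close> again.\<close>

lemma partial_in_span_products:
  assumes closed: "\<And>b. b \<in> B \<Longrightarrow> partial i b \<in> mpoly.span B"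
    and p: "p \<in> mpoly.span (products B d)"
  shows "partial i p \<in> mpoly.span (products B d)"
proof -
  have *: "partial i (prod_mset M) \<in> mpoly.span (products B (size M))" if "set_mset M \<subseteq> B" for M
    using that
  proof (induction M)
    case empty
    have "partial i 1 = (0 :: ('a, 'b) mpoly)"
      by (intro poly_mapping_eqI)
        (auto simp: lookup_partial lookup_one when_def fun_eq_iff lookup_add
          dest!: arg_cong[where f = "\<lambda>m. Poly_Mapping.lookup m i"])
    then show ?case by (simp add: mpoly.span_zero)
  next
    case (add b M)
    then have "prod_mset M \<in> mpoly.span (products B (size M))"
      by (intro mpoly.span_base) (auto simp: products_def multisets_of_size_def)
    then have "partial i b * prod_mset M \<in> mpoly.span (products B (size (add_mset b M)))"
      using mult_in_span_products[OF closed, of b "prod_mset M" "size M"] add.prems by simp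
    moreover have "b * partial i (prod_mset M) \<in> mpoly.span (products B (size (add_mset b M)))"
      using mult_in_span_products[OF mpoly.span_base, of b B "partial i (prod_mset M)" "size M"] add by simp
    ultimately show ?case
      unfolding prod_mset.add_mset partial_mult by (rule mpoly.span_add)
  qed
  show ?thesis
    using p
  proof (induction rule: mpoly.span_induct_alt)
    case base
    then show ?case by (simp add: mpoly.span_zero)
  next
    case (step c x y)
    from step(1) obtain M where "x = prod_mset M" "set_mset M \<subseteq> B" "size M = d"
      by (auto simp: products_def multisets_of_size_def)
    then show ?case
      using mpoly.span_add[OF mpoly.span_scale step(2)] *[of M] by (simp add: partial_add partial_mconst_mult)
  qed
qed

text \<open>A dimension count: the number of multisets of size \<open>d\<close> is exactly
  \<open>card C\<close>, while the span of their products contains the independent set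
  \<open>C\<close>. So there is room neither for a coincidence nor for a linear relation among the
  products.\<close>

lemma products_independent:
  fixes B C :: "('n, 'k::field) mpoly set"
  assumes "finite B" and C: "mpoly.independent C" "C \<subseteq> mpoly.span (products B d)"
    and card: "card C = (card B + d - 1) choose d"
  shows "mpoly.independent (products B d)" "inj_on prod_mset (multisets_of_size B d)"
proof -
  let ?P = "products B d"
  have fin: "finite (multisets_of_size B d)"
    using assms(1) by (rule finite_multisets_of_size)
  then have finP: "finite ?P" by (simp add: products_def)
  have cardM: "card (multisets_of_size B d) = card C"
    using assms(1) by (simp add: card card_multisets_of_size)
  have upper: "card ?P \<le> card C"
    unfolding cardM[symmetric] products_def by (rule card_image_le[OF fin])
  have lower: "card C \<le> card S" if "finite S" "?P \<subseteq> mpoly.span S" for S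
  proof -
    have "C \<subseteq> mpoly.span S"
      using C(2) mpoly.span_minimal[OF that(2) mpoly.subspace_span] by (rule order_trans)
    then show ?thesis using mpoly.independent_span_bound[OF that(1) C(1)] by blast
  qed
  \<comment> \<open>A basis of the span chosen among the products; the count forces it to contain
    all of them.\<close>
  obtain S where S: "S \<subseteq> ?P" "mpoly.independent S" "?P \<subseteq> mpoly.span S"
    by (rule mpoly.maximal_independent_subset)
  have "card ?P \<le> card S"
    using upper lower[OF finite_subset[OF S(1) finP] S(3)] by simp
  then have "S = ?P"
    by (rule card_seteq[OF finP S(1)])
  then show "mpoly.independent ?P" using S(2) by simp
  have "card ?P = card (multisets_of_size B d)"
    using upper lower[OF finP mpoly.span_superset] cardM by simp
  then show "inj_on prod_mset (multisets_of_size B d)"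
    unfolding products_def using fin by (rule eq_card_imp_inj_on[rotated])
qed

text \<open>Every linear functional on the span of \<open>B\<close> has the form \<open>p \<mapsto> (\<sigma> \<circ> p)(0)\<close>.\<close>

lemma dual_operators:
  fixes B :: "('n::finite, 'k::field_char_0) mpoly set"
  assumes "finite B" "mpoly.independent B"
  shows "\<exists>\<sigma>. \<forall>b\<in>B. \<forall>b'\<in>B. Poly_Mapping.lookup (diff_act (\<sigma> b) b') 0 = (if b = b' then 1 else 0)"
  using assms
proof (induction B)
  case (insert c B)
  let ?ev = "\<lambda>\<sigma> p. Poly_Mapping.lookup (diff_act \<sigma> p) (0 :: 'n \<Rightarrow>\<^sub>0 nat) :: 'k"
  have ev_add: "?ev (\<sigma> + \<tau>) p = ?ev \<sigma> p + ?ev \<tau> p" for \<sigma> \<tau> p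
    by (simp add: diff_act_add_left lookup_add)
  have ev_scale: "?ev (mconst k * \<sigma>) p = k * ?ev \<sigma> p" for k \<sigma> p
    by (simp add: diff_act_mult diff_act_mconst lookup_mconst_mult)
  have ev_sum: "?ev (sum s A) p = (\<Sum>a\<in>A. ?ev (s a) p)" for s p and A :: "('n, 'k) mpoly set"
    by (induction A rule: infinite_finite_induct) (simp_all add: ev_add)
  have ind: "mpoly.independent B" "c \<notin> mpoly.span B"
    using insert.prems insert.hyps by (auto simp: mpoly.independent_insert)
  obtain \<sigma> where \<sigma>: "\<And>b b'. b \<in> B \<Longrightarrow> b' \<in> B \<Longrightarrow> ?ev (\<sigma> b) b' = (if b = b' then 1 else 0)"
    using insert.IH[OF ind(1)] by blast
  \<comment> \<open>The part of \<open>c\<close> not accounted for by \<open>B\<close>. It is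
    nonzero by independence, and \<open>\<tau>\<close> below takes the value 1 on it by reading off
    one of its nonzero coefficients.\<close>
  define r where "r = c - (\<Sum>b\<in>B. mconst (?ev (\<sigma> b) c) * b)"
  have "(\<Sum>b\<in>B. mconst (?ev (\<sigma> b) c) * b) \<in> mpoly.span B"
    by (intro mpoly.span_sum mpoly.span_scale mpoly.span_base)
  then have "r \<noteq> 0" using ind(2) by (auto simp: r_def)
  then obtain m where m: "Poly_Mapping.lookup r m \<noteq> 0"
    by (metis poly_mapping_eqI lookup_zero)
  define \<tau> :: "('n, 'k) mpoly" where
    "\<tau> = Poly_Mapping.single m (1 / (mfact m * Poly_Mapping.lookup r m))"
  have ev_right_add: "?ev \<rho> (p + q) = ?ev \<rho> p + ?ev \<rho> q" for \<rho> p q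
    by (simp add: diff_act_add_right lookup_add)
  have ev_right_scale: "?ev \<rho> (mconst k * p) = k * ?ev \<rho> p" for \<rho> k p
    by (simp add: diff_act_mconst_mult lookup_mconst_mult)
  have ev_right_sum: "?ev \<rho> (sum s A) = (\<Sum>a\<in>A. ?ev \<rho> (s a))" for \<rho> s and A :: "('n, 'k) mpoly set"
    by (induction A rule: infinite_finite_induct) (simp_all add: ev_right_add)
  have "?ev \<tau> r = 1"
    using m by (simp add: \<tau>_def diff_act_single lookup_mconst_mult lookup_partial_monom_0)
  moreover have "?ev \<tau> r = ?ev \<tau> c - (\<Sum>b\<in>B. ?ev (\<sigma> b) c * ?ev \<tau> b)"
    using ev_right_add[of \<tau> r "\<Sum>b\<in>B. mconst (?ev (\<sigma> b) c) * b"]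
    by (simp add: r_def ev_right_scale ev_right_sum)
  ultimately have \<tau>c: "?ev \<tau> c = 1 + (\<Sum>b\<in>B. ?ev (\<sigma> b) c * ?ev \<tau> b)"
    by (simp add: algebra_simps)
  \<comment> \<open>The values of \<open>\<tau>\<close> on \<open>B\<close> are subtracted. The
    corrected operator kills \<open>B\<close>, and its value on \<open>c\<close> becomes that of
    \<open>\<tau>\<close> on \<open>r\<close>, which is 1.\<close>
  define \<sigma>c where "\<sigma>c = \<tau> + mconst (- 1) * (\<Sum>b\<in>B. mconst (?ev \<tau> b) * \<sigma> b)"
  have \<sigma>c_B: "?ev \<sigma>c b = 0" if "b \<in> B" for b
  proof -
    have "(\<Sum>b'\<in>B. ?ev \<tau> b' * ?ev (\<sigma> b') b) = (\<Sum>b'\<in>B. if b' = b then ?ev \<tau> b' else 0)"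
      using that by (intro sum.cong) (auto simp: \<sigma>)
    also have "\<dots> = ?ev \<tau> b" using that insert.hyps by simp
    finally show ?thesis unfolding \<sigma>c_def ev_add ev_scale ev_sum by simp
  qed
  have \<sigma>c_c: "?ev \<sigma>c c = 1"
    unfolding \<sigma>c_def ev_add ev_scale ev_sum \<tau>c by (simp add: mult.commute)
  \<comment> \<open>The old operators are made to vanish on \<open>c\<close>; as
    \<open>\<sigma>c\<close> vanishes on \<open>B\<close>, their values on \<open>B\<close> do not
    change.\<close>
  define \<sigma>' where "\<sigma>' = (\<lambda>b. if b = c then \<sigma>c else \<sigma> b + mconst (- 1) * (mconst (?ev (\<sigma> b) c) * \<sigma>c))"
  have "?ev (\<sigma>' b) b' = (if b = b' then 1 else 0)" if "b \<in> insert c B" "b' \<in> insert c B" for b b'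
    using that insert.hyps unfolding \<sigma>'_def if_distrib[of "\<lambda>\<rho>. ?ev \<rho> b'"] ev_add ev_scale
    by (auto simp: \<sigma>c_B \<sigma>c_c \<sigma>)
  then show ?case by blast
qed simp

section \<open>Degrees of derivatives, constants among them, and expansion in a dual basis\<close>

lemma mdeg_le_total_degree: "m \<in> Poly_Mapping.keys f \<Longrightarrow> mdeg m \<le> total_degree f"
  unfolding total_degree_def by (rule Max_ge) auto

text \<open>Each coefficient of a partial derivative is a multiple of a coefficient one degree
  higher, so the polynomials of degree at most deg f form a submodule containing f.\<close>

lemma lookup_diff_act_above_degree:
  fixes f :: "('n::finite, 'k::field) mpoly"
  assumes "total_degree f < mdeg m"
  shows "Poly_Mapping.lookup (diff_act \<sigma> f) m = 0"
proof -
  let ?W = "{p :: ('n, 'k) mpoly. \<forall>m. total_degree f < mdeg m \<longrightarrow> Poly_Mapping.lookup p m = 0}"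
  have "range (\<lambda>\<sigma>. diff_act \<sigma> f) \<subseteq> ?W"
  proof (rule diff_act_range_minimal)
    show "mpoly.subspace ?W"
      unfolding mpoly.subspace_def by (simp add: lookup_add lookup_mconst_mult)
    show "f \<in> ?W"
      using mdeg_le_total_degree[of _ f] by (auto simp: in_keys_iff not_le[symmetric])
    show "partial i q \<in> ?W" if "q \<in> ?W" for i q
      using that by (simp add: lookup_partial mdeg_add)
  qed
  then show ?thesis using assms by blast
qed

text \<open>Differentiation along a monomial of maximal degree in f leaves only a constant, which is
  nonzero in characteristic zero.\<close>

lemma one_in_diff_act_range:
  fixes f :: "('n::finite, 'k::field_char_0) mpoly"
  assumes "f \<noteq> 0"
  shows "1 \<in> range (\<lambda>\<sigma>. diff_act \<sigma> f)"
proof -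
  have "Max (mdeg ` Poly_Mapping.keys f) \<in> mdeg ` Poly_Mapping.keys f"
    using assms by (intro Max_in) auto
  then obtain m where m: "m \<in> Poly_Mapping.keys f" "mdeg m = Max (mdeg ` Poly_Mapping.keys f)"
    by auto
  have top: "Poly_Mapping.lookup f (k + m) = 0" if "k \<noteq> 0" for k
  proof (rule ccontr)
    assume "Poly_Mapping.lookup f (k + m) \<noteq> 0"
    then have "mdeg (k + m) \<le> mdeg m"
      unfolding m(2) by (intro Max_ge) (auto simp: in_keys_iff)
    then show False using that by (simp add: mdeg_add mdeg_eq_0_iff)
  qed
  have "Poly_Mapping.lookup (partial_monom m f) k =
      (if k = 0 then mfact m * Poly_Mapping.lookup f m else 0)" for k
    using mfact_lookup_partial_monom[of k m f] top[of k]
    by (auto simp: lookup_partial_monom_0)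
  then have "diff_act (Poly_Mapping.single m (1 / (mfact m * Poly_Mapping.lookup f m))) f = 1"
    using m(1) by (intro poly_mapping_eqI)
      (auto simp: diff_act_single lookup_mconst_mult lookup_one when_def in_keys_iff)
  then show ?thesis by (metis rangeI)
qed

lemma dual_expansion:
  assumes "finite B" "u \<in> mpoly.span B"
    and dual: "\<And>b b'. b \<in> B \<Longrightarrow> b' \<in> B \<Longrightarrow>
      Poly_Mapping.lookup (diff_act (\<sigma> b) b') 0 = (if b = b' then 1 else 0)"
  shows "u = (\<Sum>b\<in>B. mconst (Poly_Mapping.lookup (diff_act (\<sigma> b) u) 0) * b)"
  using assms(2)
proof (induction rule: mpoly.span_induct_alt)
  case (step c x y)
  have "(\<Sum>b\<in>B. mconst (Poly_Mapping.lookup (diff_act (\<sigma> b) x) 0) * b) =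
      (\<Sum>b\<in>B. if b = x then b else 0)"
    by (intro sum.cong) (auto simp: dual step(1))
  also have "\<dots> = x" using step(1) assms(1) by simp
  finally have x: "(\<Sum>b\<in>B. mconst (Poly_Mapping.lookup (diff_act (\<sigma> b) x) 0) * b) = x" .
  have "mconst (Poly_Mapping.lookup (diff_act (\<sigma> b) (mconst c * x + y)) 0) * b =
      mconst c * (mconst (Poly_Mapping.lookup (diff_act (\<sigma> b) x) 0) * b) +
      mconst (Poly_Mapping.lookup (diff_act (\<sigma> b) y) 0) * b" for b
    unfolding diff_act_add_right diff_act_mconst_mult lookup_add lookup_mconst_mult
      mconst_add mconst_mult by (simp only: distrib_right mult.assoc)
  then have "(\<Sum>b\<in>B. mconst (Poly_Mapping.lookup (diff_act (\<sigma> b) (mconst c * x + y)) 0) * b) =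
      mconst c * (\<Sum>b\<in>B. mconst (Poly_Mapping.lookup (diff_act (\<sigma> b) x) 0) * b) +
      (\<Sum>b\<in>B. mconst (Poly_Mapping.lookup (diff_act (\<sigma> b) y) 0) * b)"
    by (simp only: sum.distrib sum_distrib_left)
  also have "\<dots> = mconst c * x + y"
    by (simp only: x step(2)[symmetric])
  finally show ?case ..
qed simp

section \<open>Coefficient functionals\<close>

text \<open>These are the \<open>d\<close>-fold products from \<open>insert 1 B\<close> with factors
  1 dropped; the bound records how many factors have been used up.\<close>

definition bounded_products :: "('n, 'k::comm_ring_1) mpoly set \<Rightarrow> nat \<Rightarrow> ('n, 'k) mpoly set" where
  "bounded_products B d = prod_mset ` {M. set_mset M \<subseteq> B \<and> size M \<le> d}"

lemma mult_in_span_bounded_products: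
  assumes "p \<in> mpoly.span (bounded_products B d)" "v \<in> mpoly.span (insert 1 B)"
  shows "p * v \<in> mpoly.span (bounded_products B (Suc d))"
  using assms(1)
proof (induction rule: mpoly.span_induct_alt)
  case base
  then show ?case by (simp add: mpoly.span_zero)
next
  case (step c p q)
  from step(1) obtain M where M: "p = prod_mset M" "set_mset M \<subseteq> B" "size M \<le> d"
    by (auto simp: bounded_products_def)
  have "p * v \<in> mpoly.span (bounded_products B (Suc d))"
    using assms(2)
  proof (induction rule: mpoly.span_induct_alt)
    case base
    then show ?case by (simp add: mpoly.span_zero)
  next
    case (step c' b v')
    have "p * b \<in> bounded_products B (Suc d)"
    proof (cases "b = 1")
      case True
      then show ?thesis using M by (auto simp: bounded_products_def)
    next
      case False
      then show ?thesis
        unfolding bounded_products_def using step(1) M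
        by (intro image_eqI[of _ _ "add_mset b M"]) (auto simp: mult.commute)
    qed
    then show ?case
      using mpoly.span_add[OF mpoly.span_scale[OF mpoly.span_base] step(2), of "p * b" c']
      by (simp add: distrib_left mult.left_commute)
  qed
  then show ?case
    using mpoly.span_add[OF mpoly.span_scale step(2), of "p * v" c]
    by (simp add: distrib_right mult.assoc)
qed

interpretation mpoly_functional: vector_space_pair
  "\<lambda>(c::'k::field) (p::('n, 'k) mpoly). mconst c * p" "(*) :: 'k \<Rightarrow> 'k \<Rightarrow> 'k"
  by unfold_locales (simp_all add: algebra_simps)

abbreviation mpoly_linear :: "(('n, 'k::field) mpoly \<Rightarrow> 'k) \<Rightarrow> bool" where
  "mpoly_linear \<equiv> Vector_Spaces.linear (\<lambda>c p. mconst c * p) (*)"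

text \<open>The functional takes the coordinate at g = g 1^(d-1) in the basis of
  \<open>d\<close>-fold products. Padding by ones makes every shorter product over \<open>B\<close>
  a member of this basis.\<close>

lemma coefficient_functional:
  fixes g :: "('n, 'k::field) mpoly"
  assumes "1 \<notin> B" "g \<in> B" "0 < d"
    and indep: "mpoly.independent (products (insert 1 B) d)"
    and inj: "inj_on prod_mset (multisets_of_size (insert 1 B) d)"
  obtains \<phi> where "mpoly_linear \<phi>"
    "\<And>M. set_mset M \<subseteq> B \<Longrightarrow> size M \<le> d \<Longrightarrow> \<phi> (prod_mset M) = (if M = {#g#} then 1 else 0)"
proof -
  obtain \<phi> where \<phi>: "mpoly_linear \<phi>"
    "\<And>p. p \<in> products (insert 1 B) d \<Longrightarrow> \<phi> p = (if p = g then 1 else 0)"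
    using mpoly_functional.linear_independent_extend[OF indep, of "\<lambda>p. if p = g then 1 else 0"]
    by blast
  have "\<phi> (prod_mset M) = (if M = {#g#} then 1 else 0)" if M: "set_mset M \<subseteq> B" "size M \<le> d" for M
  proof -
    \<comment> \<open>As 1 is not in \<open>B\<close>, deleting the ones recovers the multiset, so
      injectivity of the product passes from padded multisets to shorter ones.\<close>
    let ?pad = "\<lambda>M. M + replicate_mset (d - size M) 1"
    have pad: "?pad N \<in> multisets_of_size (insert 1 B) d" "prod_mset (?pad N) = prod_mset N"
      "filter_mset (\<lambda>b. b \<noteq> 1) (?pad N) = N" if "set_mset N \<subseteq> B" "size N \<le> d" for N
    proof -
      show "?pad N \<in> multisets_of_size (insert 1 B) d"
        using that by (auto simp: multisets_of_size_def split: if_splits)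
      have "filter_mset (\<lambda>b. b \<noteq> 1) N = N"
        using that assms(1) by (intro filter_mset_eq_conv[THEN iffD2]) auto
      then show "filter_mset (\<lambda>b. b \<noteq> 1) (?pad N) = N"
        by simp
    qed simp
    have "prod_mset M = g \<longleftrightarrow> M = {#g#}"
    proof
      assume "prod_mset M = g"
      then have "prod_mset (?pad M) = prod_mset (?pad {#g#})" by simp
      then have "?pad M = ?pad {#g#}"
        using assms(2,3) by (intro inj_onD[OF inj] pad(1) M) auto
      then show "M = {#g#}"
        using pad(3)[OF M] pad(3)[of "{#g#}"] assms(2,3) by simp
    qed simp
    moreover have "prod_mset M \<in> products (insert 1 B) d"
      using pad(1,2)[OF M] unfolding products_def by (metis imageI)
    ultimately show ?thesis using \<phi>(2) by simp
  qed
  with \<phi>(1) show ?thesis by (rule that)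
qed

text \<open>A coefficient functional of degree one is a derivation at the origin.\<close>

lemma coefficient_functional_mult:
  fixes g :: "('n::finite, 'k::field) mpoly"
  assumes lin: "mpoly_linear \<phi>"
    and coeff: "\<And>M. set_mset M \<subseteq> B \<Longrightarrow> size M \<le> d \<Longrightarrow> \<phi> (prod_mset M) = (if M = {#g#} then 1 else 0)"
    and const: "\<And>b. b \<in> B \<Longrightarrow> Poly_Mapping.lookup b 0 = 0"
    and "j < d" "p \<in> mpoly.span (bounded_products B j)" "v \<in> mpoly.span (insert 1 B)"
  shows "\<phi> (p * v) = \<phi> p * Poly_Mapping.lookup v 0 + Poly_Mapping.lookup p 0 * \<phi> v"
  using assms(5)
proof (induction rule: mpoly.span_induct_alt)
  case base
  then show ?case using mpoly_functional.linear_0[OF lin] by simp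
next
  case (step c p q)
  note lin_simps = mpoly_functional.linear_add[OF lin] mpoly_functional.linear_scale[OF lin]
  from step(1) obtain M where M: "p = prod_mset M" "set_mset M \<subseteq> B" "size M \<le> j"
    by (auto simp: bounded_products_def)
  \<comment> \<open>All factors vanish at the origin, so only the empty product has a nonzero
    constant term.\<close>
  have p0: "Poly_Mapping.lookup p 0 = (if M = {#} then 1 else 0)"
  proof (cases M)
    case (add b N)
    then show ?thesis using M const[of b] by (simp add: lookup_mult_0)
  qed (simp add: M lookup_one)
  \<comment> \<open>Scalar identities that regroup the terms arising from linearity, the first in
    \<open>v\<close> and the second in \<open>p\<close>.\<close>
  have rearrange: "k * (P * B + Q * R) + (P * V + Q * W) = P * (k * B + V) + Q * (k * R + W)"
    "k * (P * V + Q * R) + (S * V + W * R) = (k * P + S) * V + (k * Q + W) * R"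
    for k P B Q R V W S :: 'k
    by (simp_all only: distrib_left distrib_right mult_ac add_ac)
  have \<phi>1: "\<phi> 1 = 0" using coeff[of "{#}"] by simp
  have \<phi>p: "\<phi> (p * v) = \<phi> p * Poly_Mapping.lookup v 0 + Poly_Mapping.lookup p 0 * \<phi> v"
    using assms(6)
  proof (induction rule: mpoly.span_induct_alt)
    case base
    then show ?case using mpoly_functional.linear_0[OF lin] by simp
  next
    case (step c' b v')
    have b: "\<phi> (p * b) = \<phi> p * Poly_Mapping.lookup b 0 + Poly_Mapping.lookup p 0 * \<phi> b"
    proof (cases "b = 1")
      case True
      then show ?thesis by (simp add: \<phi>1 lookup_one)
    next
      case False
      then have "b \<in> B" using step(1) by simp
      \<comment> \<open>Since \<open>j < d\<close>, the enlarged multiset still has size at most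
        \<open>d\<close>. It equals \<open>{#g#}\<close> only if \<open>M\<close> is empty and
        \<open>b = g\<close>, which agrees with p(0) \<phi>(b).\<close>
      moreover have "\<phi> (p * b) = (if add_mset b M = {#g#} then 1 else 0)"
        using coeff[of "add_mset b M"] M \<open>b \<in> B\<close> assms(4) by (simp add: mult.commute)
      moreover have "\<phi> b = (if b = g then 1 else 0)"
        using coeff[of "{#b#}"] \<open>b \<in> B\<close> assms(4) by simp
      ultimately show ?thesis using const[of b] by (auto simp: p0)
    qed
    have eq: "p * (mconst c' * b + v') = mconst c' * (p * b) + p * v'"
      by (simp only: distrib_left mult.left_commute)
    have "\<phi> (mconst c' * (p * b) + p * v') = c' * \<phi> (p * b) + \<phi> (p * v')"
      by (rule trans[OF lin_simps(1)]) (rule arg_cong2[OF lin_simps(2) refl])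
    moreover have "\<phi> (mconst c' * b + v') = c' * \<phi> b + \<phi> v'"
      by (rule trans[OF lin_simps(1)]) (rule arg_cong2[OF lin_simps(2) refl])
    ultimately show ?case
      by (simp only: eq lookup_add lookup_mconst_mult b step(2) rearrange(1))
  qed
  have eq: "(mconst c * p + q) * v = mconst c * (p * v) + q * v"
    by (simp only: distrib_right mult.assoc)
  have "\<phi> (mconst c * (p * v) + q * v) = c * \<phi> (p * v) + \<phi> (q * v)"
    by (rule trans[OF lin_simps(1)]) (rule arg_cong2[OF lin_simps(2) refl])
  moreover have "\<phi> (mconst c * p + q) = c * \<phi> p + \<phi> q"
    by (rule trans[OF lin_simps(1)]) (rule arg_cong2[OF lin_simps(2) refl])
  ultimately show ?case
    by (simp only: eq lookup_add lookup_mconst_mult \<phi>p step(2) rearrange(2))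
qed

text \<open>Taylor's formula gives v((j+1)x) = \<Sum>_b \<beta>_b(jx) b(x). By the derivation rule
  the term b = 1 contributes j \<phi>(v), and the terms \<beta>_b(0) \<phi>(b) add up to \<phi>(v).
  The span membership is proved alongside because the derivation rule requires it at the next
  step.\<close>

lemma coefficient_functional_dilate:
  fixes g :: "('n::finite, 'k::field_char_0) mpoly"
  assumes lin: "mpoly_linear \<phi>"
    and coeff: "\<And>M. set_mset M \<subseteq> B \<Longrightarrow> size M \<le> d \<Longrightarrow> \<phi> (prod_mset M) = (if M = {#g#} then 1 else 0)"
    and const: "\<And>b. b \<in> B \<Longrightarrow> Poly_Mapping.lookup b 0 = 0"
    and fin: "finite B"
    and indep: "mpoly.independent (insert 1 B)"
    and closed: "\<And>\<sigma> v. v \<in> mpoly.span (insert 1 B) \<Longrightarrow> diff_act \<sigma> v \<in> mpoly.span (insert 1 B)"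
    and "j \<le> d" "v \<in> mpoly.span (insert 1 B)"
  shows "dilate (of_nat j) v \<in> mpoly.span (bounded_products B j) \<and> \<phi> (dilate (of_nat j) v) = of_nat j * \<phi> v"
  using assms(7,8)
proof (induction j arbitrary: v)
  case 0
  note lin_simps = mpoly_functional.linear_add[OF lin] mpoly_functional.linear_scale[OF lin]
  \<comment> \<open>Since 0^0 = 1, dilation by zero keeps exactly the constant term.\<close>
  have "dilate 0 v = mconst (Poly_Mapping.lookup v 0) * 1"
    by (intro poly_mapping_eqI)
      (auto simp: lookup_dilate lookup_mconst_mult lookup_one when_def mdeg_eq_0_iff power_0_left
        simp del: mult_1_right)
  moreover have "1 \<in> bounded_products B 0"
    unfolding bounded_products_def by (rule image_eqI[of _ _ "{#}"]) auto
  moreover have "\<phi> 1 = 0" using coeff[of "{#}"] by simp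
  ultimately show ?case
    using mpoly.span_scale[OF mpoly.span_base, of 1 "bounded_products B 0"]
    by (simp add: lin_simps(2) del: mult_1_right)
next
  case (Suc j)
  let ?B = "insert 1 B" and ?c = "of_nat j :: 'k"
  note lin_simps = mpoly_functional.linear_sum[OF lin] mpoly_functional.linear_scale[OF lin]
  obtain \<sigma> where \<sigma>: "\<And>b b'. b \<in> ?B \<Longrightarrow> b' \<in> ?B \<Longrightarrow>
      Poly_Mapping.lookup (diff_act (\<sigma> b) b') 0 = (if b = b' then 1 else 0)"
    using dual_operators[OF _ indep] fin by blast
  let ?\<beta> = "\<lambda>b. diff_act (\<sigma> b) v"
  have B0: "Poly_Mapping.lookup b 0 = (if b = 1 then 1 else 0)" if "b \<in> ?B" for b
    using that const by (auto simp: lookup_one)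
  have expand: "u = (\<Sum>b\<in>?B. mconst (Poly_Mapping.lookup (diff_act (\<sigma> b) u) 0) * b)"
    if "u \<in> mpoly.span ?B" for u
    using fin that \<sigma> by (intro dual_expansion) auto
  have derivs: "partial_monom a v \<in> mpoly.span ?B" for a
    using closed[OF Suc.prems(2), of "Poly_Mapping.single a 1"] by (simp add: diff_act_single)
  \<comment> \<open>Among the basis elements only 1 is nonzero at the origin, so evaluating the
    expansion of each derivative of \<open>v\<close> there isolates the corresponding coefficient of
    \<open>?\<beta> 1\<close>.\<close>
  have \<beta>1: "?\<beta> 1 = v"
  proof (rule poly_mapping_eqI)
    fix a
    have "mfact a * Poly_Mapping.lookup v a = Poly_Mapping.lookup (partial_monom a v) 0"
      by (simp add: lookup_partial_monom_0)
    also have "\<dots> = (\<Sum>b\<in>?B. if b = 1 then mfact a * Poly_Mapping.lookup (?\<beta> b) a else 0)"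
      by (subst expand[OF derivs])
        (auto simp: lookup_sum lookup_mconst_mult lookup_diff_act_partial_monom_0 B0 simp del: sum.insert intro!: sum.cong)
    also have "\<dots> = mfact a * Poly_Mapping.lookup (?\<beta> 1) a"
      using fin by (subst sum.delta) auto
    finally show "Poly_Mapping.lookup (?\<beta> 1) a = Poly_Mapping.lookup v a"
      by simp
  qed
  have taylor: "dilate (of_nat (Suc j)) v = (\<Sum>b\<in>?B. dilate ?c (?\<beta> b) * b)"
    using dilate_add_1[OF expand[OF derivs], of ?c] by (simp add: add.commute)
  have IH: "dilate ?c (?\<beta> b) \<in> mpoly.span (bounded_products B j)"
    "\<phi> (dilate ?c (?\<beta> b)) = ?c * \<phi> (?\<beta> b)" for b
    using Suc.IH[OF _ closed[OF Suc.prems(2)]] Suc.prems(1) by auto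
  have "\<phi> (dilate (of_nat (Suc j)) v) = (\<Sum>b\<in>?B. \<phi> (dilate ?c (?\<beta> b) * b))"
    unfolding taylor by (rule lin_simps)
  also have "\<dots> = (\<Sum>b\<in>?B. (if b = 1 then ?c * \<phi> (?\<beta> b) else 0) + Poly_Mapping.lookup (?\<beta> b) 0 * \<phi> b)"
  proof (rule sum.cong)
    fix b assume b: "b \<in> ?B"
    have "\<phi> (dilate ?c (?\<beta> b) * b) =
        \<phi> (dilate ?c (?\<beta> b)) * Poly_Mapping.lookup b 0 + Poly_Mapping.lookup (dilate ?c (?\<beta> b)) 0 * \<phi> b"
      using Suc.prems(1) b
      by (intro coefficient_functional_mult[OF lin coeff const _ IH(1)] mpoly.span_base) auto
    moreover have "Poly_Mapping.lookup (dilate ?c (?\<beta> b)) 0 = Poly_Mapping.lookup (?\<beta> b) 0"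
      by (simp add: lookup_dilate mdeg_def)
    ultimately show "\<phi> (dilate ?c (?\<beta> b) * b) =
        (if b = 1 then ?c * \<phi> (?\<beta> b) else 0) + Poly_Mapping.lookup (?\<beta> b) 0 * \<phi> b"
      using b by (simp add: IH B0)
  qed simp
  also have "\<dots> = ?c * \<phi> v + (\<Sum>b\<in>?B. Poly_Mapping.lookup (?\<beta> b) 0 * \<phi> b)"
    using fin unfolding sum.distrib by (subst sum.delta) (auto simp: \<beta>1)
  \<comment> \<open>This is \<phi> applied to the expansion of \<open>v\<close> in the
    basis.\<close>
  also have "(\<Sum>b\<in>?B. Poly_Mapping.lookup (?\<beta> b) 0 * \<phi> b) = \<phi> v"
    by (subst (2) expand[OF Suc.prems(2)]) (simp add: lin_simps del: sum.insert)
  finally have "\<phi> (dilate (of_nat (Suc j)) v) = of_nat (Suc j) * \<phi> v"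
    by (simp add: algebra_simps)
  moreover have "dilate (of_nat (Suc j)) v \<in> mpoly.span (bounded_products B (Suc j))"
    unfolding taylor
    by (intro mpoly.span_sum mult_in_span_bounded_products IH(1) mpoly.span_base)
  ultimately show ?case by blast
qed

section \<open>Homogeneous parts and interpolation in the dilation factor\<close>

lemma lookup_hom_part: "Poly_Mapping.lookup (hom_part k p) m = (if mdeg m = k then Poly_Mapping.lookup p m else 0)"
  by (auto simp: hom_part_def lookup_sum lookup_single when_def in_keys_iff)

lemma dilate_eq_sum_hom_part:
  assumes "\<And>m. d < mdeg m \<Longrightarrow> Poly_Mapping.lookup p m = 0"
  shows "dilate c p = (\<Sum>r\<le>d. mconst (c ^ r) * hom_part r p)"
proof (rule poly_mapping_eqI)
  fix m
  have "(\<Sum>r\<le>d. c ^ r * Poly_Mapping.lookup (hom_part r p) m) =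
     (\<Sum>r\<le>d. if mdeg m = r then c ^ r * Poly_Mapping.lookup p m else 0)"
    by (intro sum.cong) (auto simp: lookup_hom_part)
  also have "\<dots> = c ^ mdeg m * Poly_Mapping.lookup p m"
    using assms[of m] by (auto simp: not_le)
  finally show "Poly_Mapping.lookup (dilate c p) m = Poly_Mapping.lookup (\<Sum>r\<le>d. mconst (c ^ r) * hom_part r p) m"
    by (simp add: lookup_dilate lookup_sum lookup_mconst_mult)
qed

text \<open>The value \<phi>(p(tx)) is a polynomial in t of degree at most \<open>d\<close> whose
  linear coefficient is \<phi>(p_1). It agrees with t \<phi>(p) at t = 0, ..., d, hence identically,
  and so \<phi>(p) = \<phi>(p_1) = 0.\<close>

lemma linear_hom_part_eq_zero_imp:
  fixes p :: "('n::finite, 'k::field_char_0) mpoly"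
  assumes lin: "mpoly_linear \<phi>" and "0 < d"
    and deg: "\<And>m. d < mdeg m \<Longrightarrow> Poly_Mapping.lookup p m = 0"
    and dil: "\<And>j. j \<le> d \<Longrightarrow> \<phi> (dilate (of_nat j) p) = of_nat j * \<phi> p"
    and "hom_part 1 p = 0"
  shows "\<phi> p = 0"
proof -
  define P Q where "P = (\<Sum>r\<le>d. Polynomial.monom (\<phi> (hom_part r p)) r)" and "Q = Polynomial.monom (\<phi> p) 1"
  have "P = Q"
  proof (rule poly_eqI_degree)
    fix x assume "x \<in> (of_nat ` {..d} :: 'k set)"
    then obtain j where j: "j \<le> d" "x = of_nat j" by auto
    have "\<phi> (dilate x p) = (\<Sum>r\<le>d. x ^ r * \<phi> (hom_part r p))"
      using dilate_eq_sum_hom_part[OF deg] 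
      by (simp add: mpoly_functional.linear_sum[OF lin] mpoly_functional.linear_scale[OF lin])
    then show "poly P x = poly Q x"
      using dil[OF j(1)] by (simp add: j(2) P_def Q_def poly_sum poly_monom mult.commute)
  next
    \<comment> \<open>Characteristic zero makes the \<open>d + 1\<close> interpolation points
      distinct; \<open>0 < d\<close> ensures that they also suffice for the linear polynomial
      \<open>Q\<close>.\<close>
    have card: "card (of_nat ` {..d} :: 'k set) = Suc d"
      by (simp add: card_image inj_on_def)
    have "degree P \<le> d"
      unfolding P_def by (intro degree_sum_le) (auto intro: degree_monom_le[THEN order_trans])
    then show "degree P < card (of_nat ` {..d} :: 'k set)" by (simp add: card)
    have "degree Q \<le> 1" unfolding Q_def by (rule degree_monom_le)
    then show "degree Q < card (of_nat ` {..d} :: 'k set)" using assms(2) by (simp add: card)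
  qed
  then have "coeff P 1 = coeff Q 1" by simp
  moreover have "coeff P 1 = \<phi> (hom_part 1 p)"
    using assms(2) by (simp add: P_def coeff_sum)
  ultimately show ?thesis
    using assms(5) mpoly_functional.linear_0[OF lin] by (simp add: Q_def)
qed

section \<open>A basis of \<D> \<circ> f adapted to an element g without terms of degree at most
  one\<close>

theorem corollary4p15:
  fixes f :: "('n::finite, 'k::{alg_closed_field, field_char_0}) mpoly"
    and l :: nat
  assumes "Ap_dim f l"
    and "\<And>d. d \<in> {1..total_degree f} \<Longrightarrow> Ap_dim (f ^ d) ((l + d - 1) choose d)"
  shows "encompassing f"
proof (rule ccontr)
  assume "\<not> encompassing f"
  then obtain g where g: "g \<in> range (\<lambda>\<sigma>. diff_act \<sigma> f)" "g \<noteq> 0" "hom_part 0 g + hom_part 1 g = 0"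
    by (auto simp: encompassing_def)
  let ?V = "range (\<lambda>\<sigma>. diff_act \<sigma> f)" and ?d = "total_degree f"
  \<comment> \<open>The parts of degrees 0 and 1 share no monomial, so both vanish with their
    sum.\<close>
  have g_low: "Poly_Mapping.lookup g m = 0" if "mdeg m \<le> 1" for m
    using that arg_cong[OF g(3), of "\<lambda>p. Poly_Mapping.lookup p m"]
    by (cases "mdeg m = 0") (auto simp: lookup_add lookup_hom_part)
  have g_high: "Poly_Mapping.lookup g m = 0" if "?d < mdeg m" for m
    using g(1) lookup_diff_act_above_degree[OF that] by auto
  \<comment> \<open>If f were constant, then g would be constant as well and hence zero.\<close>
  have d: "0 < ?d"
  proof (rule ccontr)
    assume "\<not> 0 < ?d"
    then have "Poly_Mapping.lookup g m = 0" for m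
      using g_low[of m] g_high[of m] by (cases "mdeg m = 0") auto
    then show False using g(2) by (metis poly_mapping_eqI lookup_zero)
  qed
  then have "f \<noteq> 0" by (auto simp: total_degree_def)
  then have one: "1 \<in> ?V" by (rule one_in_diff_act_range)
  have subspace: "mpoly.subspace ?V" by (rule diff_act_range_subspace)
  \<comment> \<open>Splitting off the constants yields a basis in which every element other than 1
    vanishes at the origin, as the derivation rule demands.\<close>
  define V0 where "V0 = {v \<in> ?V. Poly_Mapping.lookup v 0 = 0}"
  have V0: "mpoly.subspace V0"
  proof -
    have "mpoly.subspace {v :: ('n, 'k) mpoly. Poly_Mapping.lookup v 0 = 0}"
      unfolding mpoly.subspace_def by (simp add: lookup_add lookup_mconst_mult)
    from mpoly.subspace_inter[OF subspace this] show ?thesis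
      by (simp only: V0_def Int_def mem_Collect_eq)
  qed
  have "g \<in> V0" using g(1) g_low[of 0] by (simp add: V0_def mdeg_def)
  then obtain B where B: "{g} \<subseteq> B" "B \<subseteq> V0" "mpoly.independent B" "V0 \<subseteq> mpoly.span B"
    using mpoly.maximal_independent_subset_extend[of "{g}" V0] g(2) by auto
  let ?B = "insert 1 B"
  have const: "Poly_Mapping.lookup b 0 = 0" if "b \<in> B" for b
    using B(2) that by (auto simp: V0_def)
  have "1 \<notin> V0" by (simp add: V0_def lookup_one)
  then have notin: "1 \<notin> mpoly.span B"
    using mpoly.span_minimal[OF B(2) V0] by blast
  then have one_notin: "1 \<notin> B" using mpoly.span_base by blast
  have indep: "mpoly.independent ?B"
    by (rule mpoly.independent_insertI[OF notin B(3)])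
  have span: "mpoly.span ?B = ?V"
  proof (rule equalityI)
    show "mpoly.span ?B \<subseteq> ?V"
      using B(2) one by (intro mpoly.span_minimal subspace) (auto simp: V0_def)
    show "?V \<subseteq> mpoly.span ?B"
    proof (rule subsetI)
      fix v assume v: "v \<in> ?V"
      have "v - mconst (Poly_Mapping.lookup v 0) * 1 \<in> ?V"
        by (rule mpoly.subspace_diff[OF subspace v mpoly.subspace_scale[OF subspace one]])
      moreover have "Poly_Mapping.lookup (v - mconst (Poly_Mapping.lookup v 0) * 1) 0 = 0"
        unfolding lookup_minus lookup_mconst_mult by (simp add: lookup_one)
      ultimately have "v - mconst (Poly_Mapping.lookup v 0) * 1 \<in> V0"
        unfolding V0_def by blast
      then show "v \<in> mpoly.span ?B"
        unfolding mpoly.span_breakdown_eq using B(4) by blast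
    qed
  qed
  obtain C where C: "finite C" "mpoly.independent C" "card C = l" "mpoly.span C = ?V"
    using Ap_dim_basis[OF assms(1)] by blast
  have fin: "finite ?B"
    using mpoly.independent_span_bound[OF C(1) indep] mpoly.span_superset[of ?B] by (simp add: span C(4))
  have card: "card ?B = l"
    using mpoly.dim_span_eq_card_independent[OF indep] mpoly.dim_span_eq_card_independent[OF C(2)]
    by (simp only: span C)
  obtain Cd where Cd: "mpoly.independent Cd" "card Cd = (l + ?d - 1) choose ?d"
    "mpoly.span Cd = range (\<lambda>\<sigma>. diff_act \<sigma> (f ^ ?d))"
    using Ap_dim_basis[OF assms(2)] d by (metis Suc_leI One_nat_def atLeastAtMost_iff order_refl)
  have closed: "diff_act \<sigma> v \<in> mpoly.span ?B" if "v \<in> mpoly.span ?B" for \<sigma> v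
    using that by (auto simp: span simp flip: diff_act_mult)
  have closed_partial: "partial i b \<in> mpoly.span ?B" if "b \<in> ?B" for i b
    using closed[OF mpoly.span_base[OF that], of "mvar i"] by (simp add: diff_act_mvar)
  have "f \<in> mpoly.span ?B"
    unfolding span by (rule range_eqI[of _ _ 1]) (metis diff_act_mconst mconst_1 mult_1)
  then have "range (\<lambda>\<sigma>. diff_act \<sigma> (f ^ ?d)) \<subseteq> mpoly.span (products ?B ?d)"
    using closed_partial
    by (intro diff_act_range_minimal mpoly.subspace_span power_in_span_products partial_in_span_products)
  then have "Cd \<subseteq> mpoly.span (products ?B ?d)"
    using mpoly.span_superset[of Cd] by (simp add: Cd(3))
  \<comment> \<open>The dimension of \<D> \<circ> f^d for d = deg f equals the number of multisets
    of size d over the basis, so the counting argument applies.\<close>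
  note prods = products_independent[OF fin Cd(1) this, unfolded card, OF Cd(2)]
  obtain \<phi> where \<phi>: "mpoly_linear \<phi>"
    "\<And>M. set_mset M \<subseteq> B \<Longrightarrow> size M \<le> ?d \<Longrightarrow> \<phi> (prod_mset M) = (if M = {#g#} then 1 else 0)"
    using coefficient_functional[OF one_notin _ d prods, of g] B(1) by auto
  have "\<phi> (dilate (of_nat j) g) = of_nat j * \<phi> g" if "j \<le> ?d" for j
    using coefficient_functional_dilate[OF \<phi> const _ indep closed that, of g] fin g(1) by (simp add: span)
  moreover have "hom_part 1 g = 0"
    using g_low by (intro poly_mapping_eqI) (simp add: lookup_hom_part)
  ultimately have "\<phi> g = 0"
    using linear_hom_part_eq_zero_imp[OF \<phi>(1) d g_high] by blast
  \<comment> \<open>The singleton \<open>{#g#}\<close> is an admissible multiset because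
    \<open>0 < ?d\<close>.\<close>
  moreover have "\<phi> g = 1"
    using \<phi>(2)[of "{#g#}"] B(1) d by simp
  ultimately show False by simp
qed

end
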